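(* Let $\Sigma$ be an arbitrary group. Every difference field $K$ (with respect to $\Sigma$) embeds into a difference closed field; that is, there exist a difference closed field $L$ and an injective difference homomorphism $K\to L$.
   Context: Fix a group $\Sigma$. A difference ring is a commutative associative ring with $1$ on which $\Sigma$ acts by ring automorphisms; a difference field (difference integral domain) is a difference ring that is a field (integral domain). A difference homomorphism is a unital ring homomorphism commuting with the action of $\Sigma$. A difference ideal is an ideal $\mathfrak a$ with $\sigma(\mathfrak a)\subseteq\mathfrak a$ for all $\sigma\in\Sigma$. A difference ideal $\mathfrak a$ of $A$ is perfect if for all $a\in A$, $r\ge 1$, $\tau_1,\dots,\tau_r\in\Sigma$ and positive integers $k_1,\dots,k_r$, $\tau_1(a)^{k_1}\cdots\tau_r(a)^{k_r}\in\mathfrak a$ implies $a\in\mathfrak a$. For a difference ring $A$ and a set $Y$, the ring of difference polynomials $A\{Y\}$ is the polynomial ring over $A$ in the variables $\sigma y$ ($\sigma\in\Sigma$, $y\in Y$), with $\Sigma$ acting on $A$ as given and on variables by $\sigma(\tau y)=(\sigma\tau)y$. If $B$ is a difference ring containing $A$ as a difference subring, $f\in A\{Y\}$ is evaluated at a point $b\in B^Y$ by substituting $\sigma(b_y)$ for $\sigma y$; $b$ is a common zero of $E\subseteq A\{Y\}$ if all $f\in E$ vanish at $b$. A difference field $A$ is called difference closed if it satisfies the following two conditions (which are equivalent for difference integral domains): (B1) for every natural number $n$ and every proper perfect difference ideal $\mathfrak a\subseteq A\{y_1,\dots,y_n\}$, there exists a common zero for $\mathfrak a$ in $A^n$; (B2)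 for every natural number $n$ and every subset $E\subseteq A\{y_1,\dots,y_n\}$, if there is a common zero for $E$ in $B^n$, where $B$ is a difference integral domain containing $A$, then there is a common zero for $E$ in $A^n$. *)

theory Defs
  imports "HOL-Algebra.Indexed_Polynomials" "HOL-Algebra.Group_Action"
begin

section \<open>Difference rings\<close>

text \<open>The library's group actions are extensional: \<open>\<phi> \<sigma>\<close> is \<open>undefined\<close> outside
  \<open>carrier R\<close>. Every action becomes one of these by restriction to the carrier.\<close>

locale difference_ring = cring R + group_action G "carrier R" \<phi>
  for G :: "('g, 'w) monoid_scheme" and R :: "('a, 'm) ring_scheme" (structure)
    and \<phi> :: "'g \<Rightarrow> 'a \<Rightarrow> 'a" +
  assumes act_iso: "\<sigma> \<in> carrier G \<Longrightarrow> \<phi> \<sigma> \<in> ring_iso R R"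

locale difference_domain = difference_ring + domain R

locale difference_field = difference_ring + field R

definition difference_hom ::
  "('g, 'w) monoid_scheme \<Rightarrow> ('a, 'm) ring_scheme \<Rightarrow> ('g \<Rightarrow> 'a \<Rightarrow> 'a)
    \<Rightarrow> ('b, 'n) ring_scheme \<Rightarrow> ('g \<Rightarrow> 'b \<Rightarrow> 'b) \<Rightarrow> ('a \<Rightarrow> 'b) set"
  where "difference_hom G R \<phi> S \<psi> =
    {h \<in> ring_hom R S. \<forall>\<sigma>\<in>carrier G. \<forall>a\<in>carrier R. h (\<phi> \<sigma> a) = \<psi> \<sigma> (h a)}"

definition difference_ideal ::
  "('g, 'w) monoid_scheme \<Rightarrow> ('a, 'm) ring_scheme \<Rightarrow> ('g \<Rightarrow> 'a \<Rightarrow> 'a) \<Rightarrow> 'a set \<Rightarrow> bool"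
  where "difference_ideal G R \<phi> I \<longleftrightarrow> ideal I R \<and> (\<forall>\<sigma>\<in>carrier G. \<phi> \<sigma> ` I \<subseteq> I)"

definition perfect_difference_ideal ::
  "('g, 'w) monoid_scheme \<Rightarrow> ('a, 'm) ring_scheme \<Rightarrow> ('g \<Rightarrow> 'a \<Rightarrow> 'a) \<Rightarrow> 'a set \<Rightarrow> bool"
  where "perfect_difference_ideal G R \<phi> I \<longleftrightarrow>
    difference_ideal G R \<phi> I \<and>
    (\<forall>a\<in>carrier R. \<forall>r\<ge>1. \<forall>(\<tau> :: nat \<Rightarrow> 'g) (k :: nat \<Rightarrow> nat).
      (\<forall>i\<in>{1..r}. \<tau> i \<in> carrier G \<and> k i > 0) \<longrightarrow>
      (\<Otimes>\<^bsub>R\<^esub>i\<in>{1..r}. \<phi> (\<tau> i) a [^]\<^bsub>R\<^esub> k i) \<in> I \<longrightarrow> a \<in> I)"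


section \<open>Difference polynomials\<close>

text \<open>The library provides the underlying set of the polynomial ring over \<open>A\<close> in variables
  from \<open>V\<close> (functions from monomials, i.e. multisets of variables, to coefficients) and the
  addition, but no ring structure. The product is convolution.\<close>

definition mpoly_mult ::
  "('a, 'm) ring_scheme \<Rightarrow> ('v multiset \<Rightarrow> 'a) \<Rightarrow> ('v multiset \<Rightarrow> 'a) \<Rightarrow> ('v multiset \<Rightarrow> 'a)"
  where "mpoly_mult A p q = (\<lambda>m. \<Oplus>\<^bsub>A\<^esub>k\<in>{k. k \<subseteq># m}. p k \<otimes>\<^bsub>A\<^esub> q (m - k))"

definition mpoly_ring :: "('a, 'm) ring_scheme \<Rightarrow> 'v set \<Rightarrow> ('v multiset \<Rightarrow> 'a) ring"
  where "mpoly_ring A V =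
    \<lparr>carrier = ring.indexed_pset A V (carrier A),
     monoid.mult = mpoly_mult A,
     one = ring.indexed_const A \<one>\<^bsub>A\<^esub>,
     zero = ring.indexed_const A \<zero>\<^bsub>A\<^esub>,
     add = ring.indexed_padd A\<rparr>"

text \<open>The pair \<open>(\<sigma>, y)\<close> stands for the variable \<open>\<sigma> y\<close>.\<close>

definition dpoly_ring ::
  "('g, 'w) monoid_scheme \<Rightarrow> ('a, 'm) ring_scheme \<Rightarrow> 'y set \<Rightarrow> (('g \<times> 'y) multiset \<Rightarrow> 'a) ring"
  where "dpoly_ring G A Y = mpoly_ring A (carrier G \<times> Y)"

text \<open>\<open>\<sigma>\<close> sends \<open>\<Sum>\<^sub>m p m \<cdot> m\<close> to \<open>\<Sum>\<^sub>m \<sigma>(p m) \<cdot> \<sigma>(m)\<close>, so the coefficient of \<open>\<sigma> p\<close>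
  at \<open>m\<close> is \<open>\<sigma>(p (\<sigma>\<inverse> m))\<close>. The effect on constants, sums and products with a variable
  is given in \<open>dpoly_act_const\<close>, \<open>dpoly_act_padd\<close> and \<open>dpoly_act_pmult\<close> below.\<close>

definition dpoly_act ::
  "('g, 'w) monoid_scheme \<Rightarrow> ('a, 'm) ring_scheme \<Rightarrow> ('g \<Rightarrow> 'a \<Rightarrow> 'a) \<Rightarrow> 'y set
    \<Rightarrow> 'g \<Rightarrow> (('g \<times> 'y) multiset \<Rightarrow> 'a) \<Rightarrow> (('g \<times> 'y) multiset \<Rightarrow> 'a)"
  where "dpoly_act G A \<phi> Y \<sigma> = (\<lambda>p\<in>carrier (dpoly_ring G A Y). \<lambda>m.
    if set_mset m \<subseteq> carrier G \<times> Y
    then \<phi> \<sigma> (p (image_mset (\<lambda>(\<tau>, y). (inv\<^bsub>G\<^esub> \<sigma> \<otimes>\<^bsub>G\<^esub> \<tau>, y)) m))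
    else \<zero>\<^bsub>A\<^esub>)"

definition mpoly_eval ::
  "('a, 'm) ring_scheme \<Rightarrow> ('b, 'n) ring_scheme \<Rightarrow> ('a \<Rightarrow> 'b) \<Rightarrow> ('v \<Rightarrow> 'b)
    \<Rightarrow> ('v multiset \<Rightarrow> 'a) \<Rightarrow> 'b"
  where "mpoly_eval A B \<iota> val p =
    (\<Oplus>\<^bsub>B\<^esub>m\<in>{m. p m \<noteq> \<zero>\<^bsub>A\<^esub>}. \<iota> (p m) \<otimes>\<^bsub>B\<^esub>
      (\<Otimes>\<^bsub>B\<^esub>v\<in>set_mset m. val v [^]\<^bsub>B\<^esub> count m v))"

text \<open>Evaluation at a point \<open>b\<close> of \<open>B\<^sup>Y\<close>, where \<open>B\<close> contains \<open>A\<close> via \<open>\<iota>\<close>.\<close>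

definition dpoly_eval ::
  "('a, 'm) ring_scheme \<Rightarrow> ('b, 'n) ring_scheme \<Rightarrow> ('g \<Rightarrow> 'b \<Rightarrow> 'b) \<Rightarrow> ('a \<Rightarrow> 'b)
    \<Rightarrow> ('y \<Rightarrow> 'b) \<Rightarrow> (('g \<times> 'y) multiset \<Rightarrow> 'a) \<Rightarrow> 'b"
  where "dpoly_eval A B \<psi> \<iota> b = mpoly_eval A B \<iota> (\<lambda>(\<sigma>, y). \<psi> \<sigma> (b y))"

definition common_zero ::
  "('a, 'm) ring_scheme \<Rightarrow> ('b, 'n) ring_scheme \<Rightarrow> ('g \<Rightarrow> 'b \<Rightarrow> 'b) \<Rightarrow> ('a \<Rightarrow> 'b)
    \<Rightarrow> 'y set \<Rightarrow> (('g \<times> 'y) multiset \<Rightarrow> 'a) set \<Rightarrow> ('y \<Rightarrow> 'b) \<Rightarrow> bool"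
  where "common_zero A B \<psi> \<iota> Y E b \<longleftrightarrow>
    b \<in> Y \<rightarrow> carrier B \<and> (\<forall>p\<in>E. dpoly_eval A B \<psi> \<iota> b p = \<zero>\<^bsub>B\<^esub>)"


section \<open>Difference closed fields\<close>

definition zeros_of_perfect_ideals ::
  "('g, 'w) monoid_scheme \<Rightarrow> ('a, 'm) ring_scheme \<Rightarrow> ('g \<Rightarrow> 'a \<Rightarrow> 'a) \<Rightarrow> bool"
  where "zeros_of_perfect_ideals G A \<phi> \<longleftrightarrow>
    (\<forall>(n :: nat) I.
      perfect_difference_ideal G (dpoly_ring G A {1..n}) (dpoly_act G A \<phi> {1..n}) I \<and>
      I \<noteq> carrier (dpoly_ring G A {1..n}) \<longrightarrow>
      (\<exists>a. common_zero A A \<phi> (\<lambda>x. x) {1..n} I a))"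

definition zeros_from_extensions ::
  "'b itself \<Rightarrow> ('g, 'w) monoid_scheme \<Rightarrow> ('a, 'm) ring_scheme \<Rightarrow> ('g \<Rightarrow> 'a \<Rightarrow> 'a) \<Rightarrow> bool"
  where "zeros_from_extensions (_ :: 'b itself) G A \<phi> \<longleftrightarrow>
    (\<forall>(n :: nat) E. E \<subseteq> carrier (dpoly_ring G A {1..n}) \<longrightarrow>
      (\<exists>(B :: 'b ring) \<psi> \<iota> b.
        difference_domain G B \<psi> \<and>
        \<iota> \<in> difference_hom G A \<phi> B \<psi> \<and> inj_on \<iota> (carrier A) \<and>
        common_zero A B \<psi> \<iota> {1..n} E b) \<longrightarrow>
      (\<exists>a. common_zero A A \<phi> (\<lambda>x. x) {1..n} E a))"

text \<open>A definition cannot quantify over the type on which the extensions \<open>B\<close> live. The type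
  of sets of difference polynomials is large enough: \<open>B\<close> may be replaced by the difference
  subring generated by \<open>A\<close> and the zero, which is a quotient of \<open>A{y\<^sub>1,\<dots>,y\<^sub>n}\<close>.
  See \<open>zeros_from_extensions_all_types\<close> below.\<close>

definition difference_closed ::
  "('g, 'w) monoid_scheme \<Rightarrow> ('a, 'm) ring_scheme \<Rightarrow> ('g \<Rightarrow> 'a \<Rightarrow> 'a) \<Rightarrow> bool"
  where "difference_closed G A \<phi> \<longleftrightarrow>
    difference_field G A \<phi> \<and>
    zeros_of_perfect_ideals G A \<phi> \<and>
    zeros_from_extensions TYPE((('g \<times> nat) multiset \<Rightarrow> 'a) set) G A \<phi>"

text \<open>A type that can host a difference closed extension of a difference field of type \<open>'k\<close>.
  A system over \<open>L\<close> in finitely many indeterminates is equivalent to a subsystem of size at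
  most \<open>\<kappa> = max(|\<Sigma>|, \<aleph>\<^sub>0)\<close>, because the polynomials involving a fixed finite set of
  variables form a Noetherian ring. Hence there is an extension of cardinality at most
  \<open>max(|K|, \<kappa>)\<^sup>\<kappa>\<close>, and this type has at least that many elements.\<close>

type_synonym ('g, 'k) host = "('k + 'g + nat) list set"


section \<open>Basic facts\<close>

context cring
begin

lemma indexed_pset_coeff:
  assumes "p \<in> indexed_pset V (carrier R)" shows "p m \<in> carrier R"
  using indexed_pset_in_carrier[OF subset_refl assms] by (rule carrier_coeffE)

lemma indexed_pset_support:
  assumes "p \<in> indexed_pset V (carrier R)"
  shows "finite {m. p m \<noteq> \<zero>}" "p m \<noteq> \<zero> \<Longrightarrow> set_mset m \<subseteq> V"
proof -
  have "finite {m. p m \<noteq> \<zero>} \<and> (\<forall>m. p m \<noteq> \<zero> \<longrightarrow> set_mset m \<subseteq> V)"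
    using assms
  proof (induction rule: indexed_pset.induct)
    case (indexed_const k)
    have "{m. indexed_const k m \<noteq> \<zero>} \<subseteq> {{#}}" by (auto simp: indexed_const_def)
    from finite_subset[OF this] show ?case by (auto simp: indexed_const_def)
  next
    case (indexed_padd p q)
    have "{m. indexed_padd p q m \<noteq> \<zero>} \<subseteq> {m. p m \<noteq> \<zero>} \<union> {m. q m \<noteq> \<zero>}"
      by (auto simp: indexed_padd_def)
    from finite_subset[OF this] and indexed_padd show ?case
      by (auto simp: indexed_padd_def) (metis in_mono l_zero zero_closed)
  next
    case (indexed_pmult p i)
    have "{m. indexed_pmult p i m \<noteq> \<zero>} \<subseteq> add_mset i ` {m. p m \<noteq> \<zero>}"
    proof
      fix m assume "m \<in> {m. indexed_pmult p i m \<noteq> \<zero>}"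
      then have "p (m - {#i#}) \<noteq> \<zero>" "m = add_mset i (m - {#i#})"
        by (auto simp: indexed_pmult_def split: if_splits)
      then show "m \<in> add_mset i ` {m. p m \<noteq> \<zero>}" by blast
    qed
    from finite_subset[OF this] have "finite {m. indexed_pmult p i m \<noteq> \<zero>}"
      using indexed_pmult by blast
    moreover have "set_mset m \<subseteq> V" if "indexed_pmult p i m \<noteq> \<zero>" for m
    proof -
      have "p (m - {#i#}) \<noteq> \<zero>" "m = add_mset i (m - {#i#})"
        using that by (auto simp: indexed_pmult_def split: if_splits)
      then have "set_mset (m - {#i#}) \<subseteq> V" "set_mset m = insert i (set_mset (m - {#i#}))"
        using indexed_pmult by (blast, metis set_mset_add_mset_insert)
      then show ?thesis using indexed_pmult by simp
    qed
    ultimately show ?case by blast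
  qed
  then show "finite {m. p m \<noteq> \<zero>}" "p m \<noteq> \<zero> \<Longrightarrow> set_mset m \<subseteq> V" by blast+
qed

lemma finite_submultisets [simp]: "finite {k. k \<subseteq># (m :: 'v multiset)}"
proof -
  have "{k. k \<subseteq># m} \<subseteq> mset ` {xs. set xs \<subseteq> set_mset m \<and> length xs \<le> size m}"
  proof
    fix k assume "k \<in> {k. k \<subseteq># m}"
    moreover obtain xs where "k = mset xs" by (metis ex_mset)
    ultimately show "k \<in> mset ` {xs. set xs \<subseteq> set_mset m \<and> length xs \<le> size m}"
      using set_mset_mono[of k m] size_mset_mono[of k m] by auto
  qed
  then show ?thesis
    by (rule finite_subset) (simp add: finite_lists_length_le)
qed

lemma mpoly_mult_const:
  assumes "carrier_coeff p" "c \<in> carrier R"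
  shows "mpoly_mult R p (indexed_const c) = (\<lambda>m. p m \<otimes> c)"
  unfolding mpoly_mult_def
proof
  fix m
  have "(\<Oplus>k\<in>{k. k \<subseteq># m}. p k \<otimes> indexed_const c (m - k)) =
        (\<Oplus>k\<in>{k. k \<subseteq># m}. if m = k then p k \<otimes> c else \<zero>)"
  proof (rule finsum_cong')
    show "(\<lambda>k. if m = k then p k \<otimes> c else \<zero>) \<in> {k. k \<subseteq># m} \<rightarrow> carrier R"
      using assms by (auto simp: carrier_coeff_def)
    fix k assume "k \<in> {k. k \<subseteq># m}"
    then have "m - k = {#} \<longleftrightarrow> m = k"
      by (metis Diff_eq_empty_iff_mset mem_Collect_eq subset_mset.antisym subset_mset.refl)
    then show "p k \<otimes> indexed_const c (m - k) = (if m = k then p k \<otimes> c else \<zero>)"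
      using assms by (simp add: indexed_const_def carrier_coeff_def)
  qed simp
  also have "\<dots> = p m \<otimes> c"
    by (rule finsum_singleton) (use assms in \<open>auto simp: carrier_coeff_def\<close>)
  finally show "(\<Oplus>k\<in>{k. k \<subseteq># m}. p k \<otimes> indexed_const c (m - k)) = p m \<otimes> c" .
qed

lemma mpoly_mult_comm:
  assumes "carrier_coeff p" "carrier_coeff q"
  shows "mpoly_mult R p q = mpoly_mult R q p"
  unfolding mpoly_mult_def
proof
  fix m :: "'c multiset"
  have dd: "m - (m - k) = k" if "k \<subseteq># m" for k
    using that by (auto simp: multiset_eq_iff subseteq_mset_def)
  have inj: "inj_on (\<lambda>k. m - k) {k. k \<subseteq># m}"
    by (rule inj_on_inverseI[where g = "\<lambda>k. m - k"]) (simp add: dd)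
  have img: "(\<lambda>k. m - k) ` {k. k \<subseteq># m} = {k. k \<subseteq># m}"
  proof -
    have "k \<in> (\<lambda>k. m - k) ` {k. k \<subseteq># m}" if "k \<subseteq># m" for k
      using that by (intro image_eqI[of _ _ "m - k"]) (auto simp: dd)
    then show ?thesis by auto
  qed
  have "(\<Oplus>k\<in>{k. k \<subseteq># m}. p k \<otimes> q (m - k)) =
      (\<Oplus>k\<in>(\<lambda>k. m - k) ` {k. k \<subseteq># m}. p k \<otimes> q (m - k))"
    unfolding img ..
  also have "\<dots> = (\<Oplus>k\<in>{k. k \<subseteq># m}. p (m - k) \<otimes> q (m - (m - k)))"
    by (rule finsum_reindex[OF _ inj]) (use assms in \<open>auto simp: carrier_coeff_def\<close>)
  also have "\<dots> = (\<Oplus>k\<in>{k. k \<subseteq># m}. q k \<otimes> p (m - k))"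
    by (rule finsum_cong') (use assms in \<open>auto simp: carrier_coeff_def m_comm dd\<close>)
  finally show "(\<Oplus>k\<in>{k. k \<subseteq># m}. p k \<otimes> q (m - k)) = (\<Oplus>k\<in>{k. k \<subseteq># m}. q k \<otimes> p (m - k))" .
qed

lemma mpoly_mult_padd:
  assumes "carrier_coeff p" "carrier_coeff q" "carrier_coeff r"
  shows "mpoly_mult R p (indexed_padd q r) = indexed_padd (mpoly_mult R p q) (mpoly_mult R p r)"
  unfolding indexed_padd_def mpoly_mult_def
proof
  fix m
  have "(\<Oplus>k\<in>{k. k \<subseteq># m}. p k \<otimes> (q (m - k) \<oplus> r (m - k))) =
    (\<Oplus>k\<in>{k. k \<subseteq># m}. p k \<otimes> q (m - k) \<oplus> p k \<otimes> r (m - k))"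
    by (rule finsum_cong') (use assms in \<open>auto simp: carrier_coeff_def r_distr\<close>)
  also have "\<dots> = (\<Oplus>k\<in>{k. k \<subseteq># m}. p k \<otimes> q (m - k)) \<oplus> (\<Oplus>k\<in>{k. k \<subseteq># m}. p k \<otimes> r (m - k))"
    by (rule finsum_addf) (use assms in \<open>auto simp: carrier_coeff_def\<close>)
  finally show "(\<Oplus>k\<in>{k. k \<subseteq># m}. p k \<otimes> (q (m - k) \<oplus> r (m - k))) =
    (\<Oplus>k\<in>{k. k \<subseteq># m}. p k \<otimes> q (m - k)) \<oplus> (\<Oplus>k\<in>{k. k \<subseteq># m}. p k \<otimes> r (m - k))" .
qed

lemma mpoly_mult_pmult:
  assumes "carrier_coeff p" "carrier_coeff q"
  shows "mpoly_mult R p (indexed_pmult q i) = indexed_pmult (mpoly_mult R p q) i"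
proof
  fix m
  show "mpoly_mult R p (indexed_pmult q i) m = indexed_pmult (mpoly_mult R p q) i m"
  proof (cases "i \<in># m")
    case False
    have "mpoly_mult R p (indexed_pmult q i) m = (\<Oplus>k\<in>{k. k \<subseteq># m}. \<zero>)"
      unfolding mpoly_mult_def
      by (rule finsum_cong')
        (use assms False in \<open>auto simp: carrier_coeff_def indexed_pmult_def dest: in_diffD\<close>)
    then show ?thesis using False by (simp add: indexed_pmult_def)
  next
    case True
    have sub: "i \<in># m - k \<and> k \<subseteq># m \<longleftrightarrow> k \<subseteq># m - {#i#}" for k
    proof
      assume "i \<in># m - k \<and> k \<subseteq># m"
      then have "count k i < count m i" "\<And>a. count k a \<le> count m a"
        by (auto simp: in_diff_count subseteq_mset_def)
      then show "k \<subseteq># m - {#i#}" by (auto simp: subseteq_mset_def)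
    next
      assume "k \<subseteq># m - {#i#}"
      then have *: "count k a \<le> count m a - count {#i#} a" for a
        by (simp add: subseteq_mset_def)
      have "0 < count m i" using True by simp
      then have "count k i < count m i" using *[of i] unfolding count_single by (simp only: if_True refl)
      moreover have "count k a \<le> count m a" for a using *[of a] by linarith
      ultimately show "i \<in># m - k \<and> k \<subseteq># m"
        by (auto simp: in_diff_count subseteq_mset_def)
    qed
    have "mpoly_mult R p (indexed_pmult q i) m =
      (\<Oplus>k\<in>{k. k \<subseteq># m - {#i#}}. p k \<otimes> q (m - {#i#} - k))"
      unfolding mpoly_mult_def
    proof (rule add.finprod_mono_neutral_cong)
      show "p k \<otimes> indexed_pmult q i (m - k) = p k \<otimes> q (m - {#i#} - k)"
        if "k \<in> {k. k \<subseteq># m} \<inter> {k. k \<subseteq># m - {#i#}}" for k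
        using that sub[of k] by (auto simp: indexed_pmult_def diff_right_commute add.commute)
      show "p k \<otimes> indexed_pmult q i (m - k) = \<zero>"
        if "k \<in> {k. k \<subseteq># m} - {k. k \<subseteq># m - {#i#}}" for k
        using that sub[of k] assms by (auto simp: indexed_pmult_def carrier_coeff_def)
      show "p k \<otimes> q (m - {#i#} - k) = \<zero>"
        if "k \<in> {k. k \<subseteq># m - {#i#}} - {k. k \<subseteq># m}" for k
        using that sub[of k] by auto
    qed (use assms in \<open>auto simp: carrier_coeff_def indexed_pmult_def\<close>)
    then show ?thesis using True by (simp add: indexed_pmult_def mpoly_mult_def)
  qed
qed

lemma cmul_pset:
  fixes p :: "'v multiset \<Rightarrow> 'a"
  assumes "p \<in> indexed_pset V (carrier R)" "c \<in> carrier R"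
  shows "(\<lambda>m. p m \<otimes> c) \<in> indexed_pset V (carrier R)"
  using assms
proof (induction rule: indexed_pset.induct)
  case (indexed_const k)
  then have "(\<lambda>m :: 'v multiset. indexed_const k m \<otimes> c) = indexed_const (k \<otimes> c)"
    by (auto simp: indexed_const_def)
  moreover have "indexed_const (k \<otimes> c) \<in> indexed_pset V (carrier R)"
    using indexed_const by (intro indexed_pset.indexed_const) auto
  ultimately show ?case by (simp only:)
next
  case (indexed_padd p q)
  then have "(\<lambda>m. indexed_padd p q m \<otimes> c) = indexed_padd (\<lambda>m. p m \<otimes> c) (\<lambda>m. q m \<otimes> c)"
    by (auto simp: indexed_padd_def l_distr indexed_pset_coeff)
  then show ?case using indexed_padd by (simp add: indexed_pset.indexed_padd)
next
  case (indexed_pmult p i)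
  then have "(\<lambda>m. indexed_pmult p i m \<otimes> c) = indexed_pmult (\<lambda>m. p m \<otimes> c) i"
    by (auto simp: indexed_pmult_def)
  then show ?case using indexed_pmult by (simp add: indexed_pset.indexed_pmult)
qed

lemma pset_carrier_coeff: "p \<in> indexed_pset V (carrier R) \<Longrightarrow> carrier_coeff p"
  using indexed_pset_in_carrier by blast

lemma mpoly_mult_pset:
  assumes "p \<in> indexed_pset V (carrier R)" "q \<in> indexed_pset V (carrier R)"
  shows "mpoly_mult R p q \<in> indexed_pset V (carrier R)"
  using assms(2,1)
  by (induction rule: indexed_pset.induct)
    (simp_all add: mpoly_mult_const mpoly_mult_padd mpoly_mult_pmult cmul_pset pset_carrier_coeff[where V=V]
      indexed_pset.indexed_padd indexed_pset.indexed_pmult)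

lemma cmul_mpoly_mult:
  assumes "carrier_coeff p" "carrier_coeff q" "c \<in> carrier R"
  shows "mpoly_mult R p (\<lambda>m. q m \<otimes> c) = (\<lambda>m. mpoly_mult R p q m \<otimes> c)"
proof
  fix m
  have "mpoly_mult R p q m \<otimes> c = (\<Oplus>k\<in>{k. k \<subseteq># m}. p k \<otimes> q (m - k) \<otimes> c)"
    unfolding mpoly_mult_def
    by (rule finsum_ldistr) (use assms in \<open>auto simp: carrier_coeff_def\<close>)
  also have "\<dots> = mpoly_mult R p (\<lambda>m. q m \<otimes> c) m"
    unfolding mpoly_mult_def
    by (rule finsum_cong') (use assms in \<open>auto simp: carrier_coeff_def m_assoc\<close>)
  finally show "mpoly_mult R p (\<lambda>m. q m \<otimes> c) m = mpoly_mult R p q m \<otimes> c" ..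
qed

lemma mpoly_mult_assoc:
  assumes "p \<in> indexed_pset V (carrier R)" "q \<in> indexed_pset V (carrier R)"
    "r \<in> indexed_pset V (carrier R)"
  shows "mpoly_mult R (mpoly_mult R p q) r = mpoly_mult R p (mpoly_mult R q r)"
  using assms(3)
proof (induction rule: indexed_pset.induct)
  case (indexed_const k)
  then show ?case
    using assms mpoly_mult_pset[OF assms(1,2)] by (simp add: mpoly_mult_const cmul_mpoly_mult pset_carrier_coeff[where V=V])
next
  case (indexed_padd r s)
  note c = assms(1,2) this mpoly_mult_pset[OF assms(1,2)] mpoly_mult_pset[OF assms(2)]
  then show ?case by (simp add: mpoly_mult_padd pset_carrier_coeff[where V=V])
next
  case (indexed_pmult r i)
  note c = assms(1,2) this mpoly_mult_pset[OF assms(1,2)] mpoly_mult_pset[OF assms(2)]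
  then show ?case by (simp add: mpoly_mult_pmult pset_carrier_coeff[where V=V])
qed

lemma cring_mpoly_ring: "cring (mpoly_ring R V)"
proof (rule cringI)
  show "abelian_group (mpoly_ring R V)"
  proof (rule abelian_groupI)
    fix p q r assume "p \<in> carrier (mpoly_ring R V)" "q \<in> carrier (mpoly_ring R V)"
      "r \<in> carrier (mpoly_ring R V)"
    then have p: "p \<in> indexed_pset V (carrier R)" and q: "q \<in> indexed_pset V (carrier R)"
      and r: "r \<in> indexed_pset V (carrier R)" by (auto simp: mpoly_ring_def)
    note c = p[THEN indexed_pset_coeff] q[THEN indexed_pset_coeff] r[THEN indexed_pset_coeff]
    show "p \<oplus>\<^bsub>mpoly_ring R V\<^esub> q \<in> carrier (mpoly_ring R V)"
      using p q by (simp add: mpoly_ring_def indexed_pset.indexed_padd)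
    show "p \<oplus>\<^bsub>mpoly_ring R V\<^esub> q \<oplus>\<^bsub>mpoly_ring R V\<^esub> r = p \<oplus>\<^bsub>mpoly_ring R V\<^esub> (q \<oplus>\<^bsub>mpoly_ring R V\<^esub> r)"
      "p \<oplus>\<^bsub>mpoly_ring R V\<^esub> q = q \<oplus>\<^bsub>mpoly_ring R V\<^esub> p"
      "\<zero>\<^bsub>mpoly_ring R V\<^esub> \<oplus>\<^bsub>mpoly_ring R V\<^esub> p = p"
      using c by (auto simp: mpoly_ring_def indexed_padd_def indexed_const_def a_assoc intro: a_comm)
    define p' where "p' = (\<lambda>m. p m \<otimes> \<ominus> \<one>)"
    have "p' \<in> carrier (mpoly_ring R V)"
      using cmul_pset[OF p, of "\<ominus> \<one>"] by (simp add: p'_def mpoly_ring_def)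
    moreover have "p' \<oplus>\<^bsub>mpoly_ring R V\<^esub> p = \<zero>\<^bsub>mpoly_ring R V\<^esub>"
      using c by (auto simp: p'_def mpoly_ring_def indexed_padd_def indexed_const_def r_minus l_neg)
    ultimately show "\<exists>q\<in>carrier (mpoly_ring R V). q \<oplus>\<^bsub>mpoly_ring R V\<^esub> p = \<zero>\<^bsub>mpoly_ring R V\<^esub>"
      by blast
  qed (simp add: mpoly_ring_def indexed_pset.indexed_const)
next
  show "Group.comm_monoid (mpoly_ring R V)"
  proof (rule comm_monoidI)
    fix p assume "p \<in> carrier (mpoly_ring R V)"
    then have p: "p \<in> indexed_pset V (carrier R)" by (simp add: mpoly_ring_def)
    have "mpoly_mult R (indexed_const \<one>) p = mpoly_mult R p (indexed_const \<one>)"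
      by (rule mpoly_mult_comm) (use indexed_pset_coeff[OF p] in \<open>auto simp: carrier_coeff_def indexed_const_def\<close>)
    moreover have "p m \<in> carrier R" for m using p by (rule indexed_pset_coeff)
    ultimately show "\<one>\<^bsub>mpoly_ring R V\<^esub> \<otimes>\<^bsub>mpoly_ring R V\<^esub> p = p"
      using p by (simp add: mpoly_ring_def mpoly_mult_const pset_carrier_coeff[where V=V]
          indexed_pset_coeff[where V=V])
  qed (auto simp: mpoly_ring_def mpoly_mult_pset mpoly_mult_assoc indexed_pset.indexed_const
      intro: mpoly_mult_comm pset_carrier_coeff[where V=V])
next
  fix p q r assume "p \<in> carrier (mpoly_ring R V)" "q \<in> carrier (mpoly_ring R V)"
    "r \<in> carrier (mpoly_ring R V)"
  then have "p \<in> indexed_pset V (carrier R)" "q \<in> indexed_pset V (carrier R)"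
      "r \<in> indexed_pset V (carrier R)" by (auto simp: mpoly_ring_def)
  then show "(p \<oplus>\<^bsub>mpoly_ring R V\<^esub> q) \<otimes>\<^bsub>mpoly_ring R V\<^esub> r =
    p \<otimes>\<^bsub>mpoly_ring R V\<^esub> r \<oplus>\<^bsub>mpoly_ring R V\<^esub> q \<otimes>\<^bsub>mpoly_ring R V\<^esub> r"
    by (simp add: mpoly_ring_def mpoly_mult_comm[of _ r] mpoly_mult_padd pset_carrier_coeff[where V=V] indexed_pset.indexed_padd)
qed

end


locale mpoly_eval_at = A: cring A + B: cring B
  for A :: "('a, 'm) ring_scheme" and B :: "('b, 'n) ring_scheme" +
  fixes \<iota> :: "'a \<Rightarrow> 'b" and V :: "'v set" and val :: "'v \<Rightarrow> 'b"
  assumes hom: "\<iota> \<in> ring_hom A B" and val: "v \<in> V \<Longrightarrow> val v \<in> carrier B"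
begin

abbreviation mono :: "'v multiset \<Rightarrow> 'b"
  where "mono m \<equiv> \<Otimes>\<^bsub>B\<^esub>v\<in>set_mset m. val v [^]\<^bsub>B\<^esub> count m v"

abbreviation ev :: "('v multiset \<Rightarrow> 'a) \<Rightarrow> 'b"
  where "ev \<equiv> mpoly_eval A B \<iota> val"

abbreviation P :: "('v multiset \<Rightarrow> 'a) set"
  where "P \<equiv> A.indexed_pset V (carrier A)"

lemma \<iota>: "x \<in> carrier A \<Longrightarrow> \<iota> x \<in> carrier B" "\<iota> \<zero>\<^bsub>A\<^esub> = \<zero>\<^bsub>B\<^esub>"
  using hom ring_hom_zero[OF hom A.ring_axioms B.ring_axioms] by (auto simp: ring_hom_closed)

lemma mono_closed: "set_mset m \<subseteq> V \<Longrightarrow> mono m \<in> carrier B"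
  by (rule B.finprod_closed) (auto intro!: B.nat_pow_closed val)

lemma mono_add_mset:
  assumes "set_mset m \<subseteq> V" "i \<in> V"
  shows "mono (add_mset i m) = mono m \<otimes>\<^bsub>B\<^esub> val i"
proof -
  define S where "S = set_mset m - {i}"
  define Q where "Q = (\<Otimes>\<^bsub>B\<^esub>v\<in>S. val v [^]\<^bsub>B\<^esub> count m v)"
  have v: "val v [^]\<^bsub>B\<^esub> n \<in> carrier B" if "v \<in> insert i S" for v and n :: nat
    using that assms val by (auto simp: S_def)
  have S: "finite S" "i \<notin> S" by (auto simp: S_def)
  have Q: "Q \<in> carrier B" unfolding Q_def by (rule B.finprod_closed) (use v in auto)
  have "mono (add_mset i m) = (\<Otimes>\<^bsub>B\<^esub>v\<in>insert i S. val v [^]\<^bsub>B\<^esub> count (add_mset i m) v)"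
    by (rule B.finprod_cong') (use v val[OF assms(2)] in \<open>auto simp: S_def simp del: B.nat_pow_Suc\<close>)
  also have "\<dots> = val i [^]\<^bsub>B\<^esub> count (add_mset i m) i \<otimes>\<^bsub>B\<^esub>
      (\<Otimes>\<^bsub>B\<^esub>v\<in>S. val v [^]\<^bsub>B\<^esub> count (add_mset i m) v)"
    by (rule B.finprod_insert) (use S v in \<open>auto simp del: B.nat_pow_Suc count_add_mset\<close>)
  also have "(\<Otimes>\<^bsub>B\<^esub>v\<in>S. val v [^]\<^bsub>B\<^esub> count (add_mset i m) v) = Q"
    unfolding Q_def by (rule B.finprod_cong') (use v S in auto)
  finally have 1: "mono (add_mset i m) = val i [^]\<^bsub>B\<^esub> Suc (count m i) \<otimes>\<^bsub>B\<^esub> Q" by simp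
  have "mono m = (\<Otimes>\<^bsub>B\<^esub>v\<in>insert i S. val v [^]\<^bsub>B\<^esub> count m v)"
  proof (rule B.finprod_mono_neutral_cong_left)
    show "val v [^]\<^bsub>B\<^esub> count m v = \<one>\<^bsub>B\<^esub>" if "v \<in> insert i S - set_mset m" for v
      using that S by (auto simp: S_def not_in_iff)
  qed (use v in \<open>auto simp: S_def\<close>)
  also have "\<dots> = val i [^]\<^bsub>B\<^esub> count m i \<otimes>\<^bsub>B\<^esub> Q"
    unfolding Q_def by (rule B.finprod_insert) (use S v in auto)
  finally show ?thesis
    using 1 Q val[OF assms(2)] by (simp add: B.m_ac)
qed

lemma ev_superset:
  assumes "p \<in> P" "finite F" "{m. p m \<noteq> \<zero>\<^bsub>A\<^esub>} \<subseteq> F" "\<And>m. m \<in> F \<Longrightarrow> set_mset m \<subseteq> V"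
  shows "ev p = (\<Oplus>\<^bsub>B\<^esub>m\<in>F. \<iota> (p m) \<otimes>\<^bsub>B\<^esub> mono m)"
  unfolding mpoly_eval_def
  by (rule B.add.finprod_mono_neutral_cong_left)
    (use assms in \<open>auto intro!: B.m_closed B.l_null \<iota> A.indexed_pset_coeff mono_closed simp: \<iota>(2)\<close>)

lemma term_closed:
  "p \<in> P \<Longrightarrow> set_mset m \<subseteq> V \<Longrightarrow> \<iota> (p m) \<otimes>\<^bsub>B\<^esub> mono m \<in> carrier B"
  by (intro B.m_closed \<iota> A.indexed_pset_coeff mono_closed)

lemma ev_closed: "p \<in> P \<Longrightarrow> ev p \<in> carrier B"
  unfolding mpoly_eval_def
  by (rule B.finsum_closed) (auto intro!: term_closed dest: A.indexed_pset_support)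

lemma ev_const:
  assumes "c \<in> carrier A" shows "ev (A.indexed_const c) = \<iota> c"
proof -
  have "ev (A.indexed_const c) = (\<Oplus>\<^bsub>B\<^esub>m\<in>{{#}}. \<iota> (A.indexed_const c m) \<otimes>\<^bsub>B\<^esub> mono m)"
  proof (rule ev_superset)
    show "A.indexed_const c \<in> P" using assms by (rule A.indexed_pset.indexed_const)
  qed (auto simp: A.indexed_const_def split: if_splits)
  also have "\<dots> = \<iota> c" using assms \<iota> by (simp add: A.indexed_const_def)
  finally show ?thesis .
qed

lemma ev_padd:
  assumes "p \<in> P" "q \<in> P" shows "ev (A.indexed_padd p q) = ev p \<oplus>\<^bsub>B\<^esub> ev q"
proof -
  define F where "F = {m. p m \<noteq> \<zero>\<^bsub>A\<^esub>} \<union> {m. q m \<noteq> \<zero>\<^bsub>A\<^esub>}"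
  have F: "finite F" "\<And>m. m \<in> F \<Longrightarrow> set_mset m \<subseteq> V"
    unfolding F_def using assms A.indexed_pset_support by (blast, blast)
  have "ev (A.indexed_padd p q) = (\<Oplus>\<^bsub>B\<^esub>m\<in>F. \<iota> (A.indexed_padd p q m) \<otimes>\<^bsub>B\<^esub> mono m)"
  proof (rule ev_superset)
    show "A.indexed_padd p q \<in> P" using assms by (rule A.indexed_pset.indexed_padd)
  qed (use F in \<open>auto simp: A.indexed_padd_def F_def\<close>)
  also have "\<dots> = (\<Oplus>\<^bsub>B\<^esub>m\<in>F. \<iota> (p m) \<otimes>\<^bsub>B\<^esub> mono m \<oplus>\<^bsub>B\<^esub> \<iota> (q m) \<otimes>\<^bsub>B\<^esub> mono m)"
  proof (rule B.finsum_cong')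
    fix m assume "m \<in> F"
    then show "\<iota> (A.indexed_padd p q m) \<otimes>\<^bsub>B\<^esub> mono m =
        \<iota> (p m) \<otimes>\<^bsub>B\<^esub> mono m \<oplus>\<^bsub>B\<^esub> \<iota> (q m) \<otimes>\<^bsub>B\<^esub> mono m"
      using assms[THEN A.indexed_pset_coeff] mono_closed[OF F(2)] \<iota>(1)
      by (simp add: A.indexed_padd_def ring_hom_add[OF hom] B.l_distr)
  qed (use assms F in \<open>auto intro!: term_closed\<close>)
  also have "\<dots> = (\<Oplus>\<^bsub>B\<^esub>m\<in>F. \<iota> (p m) \<otimes>\<^bsub>B\<^esub> mono m) \<oplus>\<^bsub>B\<^esub> (\<Oplus>\<^bsub>B\<^esub>m\<in>F. \<iota> (q m) \<otimes>\<^bsub>B\<^esub> mono m)"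
    by (rule B.finsum_addf) (use assms F in \<open>auto intro!: term_closed\<close>)
  also have "(\<Oplus>\<^bsub>B\<^esub>m\<in>F. \<iota> (p m) \<otimes>\<^bsub>B\<^esub> mono m) = ev p"
    by (rule ev_superset[symmetric]) (use assms F in \<open>auto simp: F_def\<close>)
  also have "(\<Oplus>\<^bsub>B\<^esub>m\<in>F. \<iota> (q m) \<otimes>\<^bsub>B\<^esub> mono m) = ev q"
    by (rule ev_superset[symmetric]) (use assms F in \<open>auto simp: F_def\<close>)
  finally show ?thesis .
qed

lemma ev_pmult:
  assumes "p \<in> P" "i \<in> V" shows "ev (A.indexed_pmult p i) = ev p \<otimes>\<^bsub>B\<^esub> val i"
proof -
  define F where "F = {m. p m \<noteq> \<zero>\<^bsub>A\<^esub>}"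
  have F: "finite F" "\<And>m. m \<in> F \<Longrightarrow> set_mset m \<subseteq> V"
    unfolding F_def using assms A.indexed_pset_support by (blast, blast)
  have "ev (A.indexed_pmult p i) =
      (\<Oplus>\<^bsub>B\<^esub>m\<in>add_mset i ` F. \<iota> (A.indexed_pmult p i m) \<otimes>\<^bsub>B\<^esub> mono m)"
  proof (rule ev_superset)
    show "{m. A.indexed_pmult p i m \<noteq> \<zero>\<^bsub>A\<^esub>} \<subseteq> add_mset i ` F"
    proof
      fix m assume "m \<in> {m. A.indexed_pmult p i m \<noteq> \<zero>\<^bsub>A\<^esub>}"
      then have "m - {#i#} \<in> F" "m = add_mset i (m - {#i#})"
        by (auto simp: A.indexed_pmult_def F_def split: if_splits)
      then show "m \<in> add_mset i ` F" by blast
    qed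
  qed (use assms F(1) subsetD[OF F(2)] in \<open>auto intro: A.indexed_pset.indexed_pmult\<close>)
  also have "\<dots> = (\<Oplus>\<^bsub>B\<^esub>m\<in>F. \<iota> (A.indexed_pmult p i (add_mset i m)) \<otimes>\<^bsub>B\<^esub> mono (add_mset i m))"
    by (rule B.finsum_reindex)
      (use assms subsetD[OF F(2)] in \<open>auto intro!: term_closed A.indexed_pset.indexed_pmult simp: inj_on_def\<close>)
  also have "\<dots> = (\<Oplus>\<^bsub>B\<^esub>m\<in>F. \<iota> (p m) \<otimes>\<^bsub>B\<^esub> mono m \<otimes>\<^bsub>B\<^esub> val i)"
  proof (rule B.finsum_cong')
    fix m assume m: "m \<in> F"
    have "A.indexed_pmult p i (add_mset i m) = p m" by (simp add: A.indexed_pmult_def)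
    then show "\<iota> (A.indexed_pmult p i (add_mset i m)) \<otimes>\<^bsub>B\<^esub> mono (add_mset i m) =
        \<iota> (p m) \<otimes>\<^bsub>B\<^esub> mono m \<otimes>\<^bsub>B\<^esub> val i"
      using mono_add_mset[OF F(2)[OF m] assms(2)] mono_closed[OF F(2)[OF m]] val[OF assms(2)]
        \<iota>(1)[OF A.indexed_pset_coeff[OF assms(1)]] by (simp add: B.m_assoc)
  qed (use assms F val in \<open>auto intro!: term_closed\<close>)
  also have "\<dots> = (\<Oplus>\<^bsub>B\<^esub>m\<in>F. \<iota> (p m) \<otimes>\<^bsub>B\<^esub> mono m) \<otimes>\<^bsub>B\<^esub> val i"
    by (rule B.finsum_ldistr[symmetric]) (use assms F val in \<open>auto intro!: term_closed\<close>)
  also have "(\<Oplus>\<^bsub>B\<^esub>m\<in>F. \<iota> (p m) \<otimes>\<^bsub>B\<^esub> mono m) = ev p"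
    by (rule ev_superset[symmetric]) (use assms F in \<open>auto simp: F_def\<close>)
  finally show ?thesis .
qed

lemma ev_cmul:
  assumes "p \<in> P" "c \<in> carrier A"
  shows "ev (\<lambda>m. p m \<otimes>\<^bsub>A\<^esub> c) = ev p \<otimes>\<^bsub>B\<^esub> \<iota> c"
  using assms(1)
proof (induction rule: A.indexed_pset.induct)
  case (indexed_const k)
  have "(\<lambda>m :: 'v multiset. A.indexed_const k m \<otimes>\<^bsub>A\<^esub> c) = A.indexed_const (k \<otimes>\<^bsub>A\<^esub> c)"
    using assms(2) by (auto simp: A.indexed_const_def)
  then show ?case
    using indexed_const assms(2) by (simp add: ev_const ring_hom_mult[OF hom])
next
  case (indexed_padd p q)
  have "(\<lambda>m. A.indexed_padd p q m \<otimes>\<^bsub>A\<^esub> c) =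
      A.indexed_padd (\<lambda>m. p m \<otimes>\<^bsub>A\<^esub> c) (\<lambda>m. q m \<otimes>\<^bsub>A\<^esub> c)"
    using indexed_padd(1,2)[THEN A.indexed_pset_coeff] assms(2)
    by (simp add: A.indexed_padd_def A.l_distr)
  then show ?case
    using indexed_padd assms(2) \<iota> A.cmul_pset[where V=V]
    by (simp add: ev_padd ev_closed B.l_distr)
next
  case (indexed_pmult p i)
  have "(\<lambda>m. A.indexed_pmult p i m \<otimes>\<^bsub>A\<^esub> c) = A.indexed_pmult (\<lambda>m. p m \<otimes>\<^bsub>A\<^esub> c) i"
    using assms(2) by (auto simp: A.indexed_pmult_def)
  then show ?case
    using indexed_pmult assms(2) \<iota> A.cmul_pset[where V=V] val
    by (simp add: ev_pmult ev_closed B.m_ac)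
qed

lemma ev_mult:
  assumes "p \<in> P" "q \<in> P" shows "ev (mpoly_mult A p q) = ev p \<otimes>\<^bsub>B\<^esub> ev q"
  using assms(2)
proof (induction rule: A.indexed_pset.induct)
  case (indexed_const k)
  then show ?case
    using assms(1) by (simp add: A.mpoly_mult_const A.pset_carrier_coeff[where V=V] ev_cmul ev_const)
next
  case (indexed_padd q r)
  then show ?case
    using assms(1)
    by (simp add: A.mpoly_mult_padd A.pset_carrier_coeff[where V=V] A.mpoly_mult_pset ev_padd
        ev_closed B.r_distr)
next
  case (indexed_pmult q i)
  then show ?case
    using assms(1) val
    by (simp add: A.mpoly_mult_pmult A.pset_carrier_coeff[where V=V] A.mpoly_mult_pset ev_pmult
        ev_closed B.m_assoc)
qed

lemma ev_ring_hom: "ev \<in> ring_hom (mpoly_ring A V) B"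
proof (rule ring_hom_memI)
  show "ev \<one>\<^bsub>mpoly_ring A V\<^esub> = \<one>\<^bsub>B\<^esub>"
    by (simp add: mpoly_ring_def ev_const ring_hom_one[OF hom])
qed (simp_all add: mpoly_ring_def ev_closed ev_padd ev_mult)

end


lemma difference_ringI:
  assumes "cring R" "Group.group G"
    and hom: "\<And>\<sigma>. \<sigma> \<in> carrier G \<Longrightarrow> \<phi> \<sigma> \<in> ring_hom R R"
    and ext: "\<And>\<sigma>. \<sigma> \<in> carrier G \<Longrightarrow> \<phi> \<sigma> \<in> extensional (carrier R)"
    and one: "\<And>x. x \<in> carrier R \<Longrightarrow> \<phi> \<one>\<^bsub>G\<^esub> x = x"
    and mult: "\<And>\<sigma> \<tau> x. \<sigma> \<in> carrier G \<Longrightarrow> \<tau> \<in> carrier G \<Longrightarrow> x \<in> carrier R \<Longrightarrow>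
      \<phi> (\<sigma> \<otimes>\<^bsub>G\<^esub> \<tau>) x = \<phi> \<sigma> (\<phi> \<tau> x)"
  shows "difference_ring G R \<phi>"
proof -
  interpret R: cring R by fact
  interpret G: Group.group G by fact
  have closed: "\<phi> \<sigma> x \<in> carrier R" if "\<sigma> \<in> carrier G" "x \<in> carrier R" for \<sigma> x
    using ring_hom_closed[OF hom] that by blast
  have bij: "bij_betw (\<phi> \<sigma>) (carrier R) (carrier R)" if \<sigma>: "\<sigma> \<in> carrier G" for \<sigma>
    by (rule bij_betw_byWitness[where f' = "\<phi> (inv\<^bsub>G\<^esub> \<sigma>)"])
      (use \<sigma> closed one in \<open>auto simp: mult[symmetric]\<close>)
  have Bij: "\<phi> \<sigma> \<in> Bij (carrier R)" if "\<sigma> \<in> carrier G" for \<sigma>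
    using bij ext that by (simp add: Bij_def)
  have "\<phi> (\<sigma> \<otimes>\<^bsub>G\<^esub> \<tau>) = compose (carrier R) (\<phi> \<sigma>) (\<phi> \<tau>)"
    if "\<sigma> \<in> carrier G" "\<tau> \<in> carrier G" for \<sigma> \<tau>
    by (rule extensionalityI[of _ "carrier R"]) (use that ext mult in \<open>auto simp: compose_eq\<close>)
  then have "\<phi> \<in> hom G (BijGroup (carrier R))"
    by (auto simp: hom_def BijGroup_def Bij)
  then have "group_action G (carrier R) \<phi>"
    by (simp add: group_action_def group_hom_def group_hom_axioms_def group_BijGroup G.group_axioms)
  moreover have "\<phi> \<sigma> \<in> ring_iso R R" if "\<sigma> \<in> carrier G" for \<sigma>
    using bij hom that by (simp add: ring_iso_def)
  ultimately show ?thesis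
    by (simp add: difference_ring_def difference_ring_axioms_def R.cring_axioms)
qed

context difference_ring
begin

lemma group_G: "Group.group G"
  using group_hom by (simp add: group_hom_def)

lemma act_hom: "\<sigma> \<in> carrier G \<Longrightarrow> \<phi> \<sigma> \<in> ring_hom R R"
  using act_iso by (simp add: ring_iso_def)

lemma act_closed: "\<sigma> \<in> carrier G \<Longrightarrow> x \<in> carrier R \<Longrightarrow> \<phi> \<sigma> x \<in> carrier R"
  by (rule ring_hom_closed[OF act_hom])

lemma act_zero: "\<sigma> \<in> carrier G \<Longrightarrow> \<phi> \<sigma> \<zero> = \<zero>"
  using ring_hom_zero[OF act_hom ring_axioms ring_axioms] .

lemma act_one: "x \<in> carrier R \<Longrightarrow> \<phi> \<one>\<^bsub>G\<^esub> x = x"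
  using id_eq_one by (metis restrict_apply')

lemma act_mult:
  "\<sigma> \<in> carrier G \<Longrightarrow> \<tau> \<in> carrier G \<Longrightarrow> x \<in> carrier R \<Longrightarrow> \<phi> (\<sigma> \<otimes>\<^bsub>G\<^esub> \<tau>) x = \<phi> \<sigma> (\<phi> \<tau> x)"
  by (rule composition_rule)

abbreviation PY :: "'y set \<Rightarrow> (('g \<times> 'y) multiset \<Rightarrow> 'a) set"
  where "PY Y \<equiv> indexed_pset (carrier G \<times> Y) (carrier R)"

lemma carrier_dpoly_ring: "carrier (dpoly_ring G R Y) = PY Y"
  by (simp add: dpoly_ring_def mpoly_ring_def)

lemma dpoly_act_const:
  assumes "\<sigma> \<in> carrier G" "c \<in> carrier R"
  shows "dpoly_act G R \<phi> Y \<sigma> (indexed_const c) = indexed_const (\<phi> \<sigma> c)"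
proof -
  have "indexed_const c \<in> PY Y" using assms(2) by (rule indexed_pset.indexed_const)
  then have "dpoly_act G R \<phi> Y \<sigma> (indexed_const c) m = indexed_const (\<phi> \<sigma> c) m" for m
    using assms act_zero
    by (simp add: dpoly_act_def carrier_dpoly_ring) (simp add: indexed_const_def)
  then show ?thesis ..
qed

lemma dpoly_act_padd:
  assumes "\<sigma> \<in> carrier G" "p \<in> PY Y" "q \<in> PY Y"
  shows "dpoly_act G R \<phi> Y \<sigma> (indexed_padd p q) =
    indexed_padd (dpoly_act G R \<phi> Y \<sigma> p) (dpoly_act G R \<phi> Y \<sigma> q)"
proof -
  have "indexed_padd p q \<in> PY Y" using assms(2,3) by (rule indexed_pset.indexed_padd)
  then show ?thesis
    using assms indexed_pset_coeff[OF assms(2)] indexed_pset_coeff[OF assms(3)]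
    by (auto simp: dpoly_act_def carrier_dpoly_ring fun_eq_iff ring_hom_add[OF act_hom]
        simp: indexed_padd_def)
qed

lemma dpoly_act_pmult:
  fixes Y :: "'y set"
  assumes "\<sigma> \<in> carrier G" "p \<in> PY Y" "\<tau> \<in> carrier G" "y \<in> Y"
  shows "dpoly_act G R \<phi> Y \<sigma> (indexed_pmult p (\<tau>, y)) =
    indexed_pmult (dpoly_act G R \<phi> Y \<sigma> p) (\<sigma> \<otimes>\<^bsub>G\<^esub> \<tau>, y)"
proof
  interpret G: Group.group G by (rule group_G)
  fix m :: "('g \<times> 'y) multiset"
  let ?h = "\<lambda>(\<tau>, y). (inv\<^bsub>G\<^esub> \<sigma> \<otimes>\<^bsub>G\<^esub> \<tau>, y) :: 'g \<times> 'y"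
  let ?i = "(\<sigma> \<otimes>\<^bsub>G\<^esub> \<tau>, y)"
  have i: "?i \<in> carrier G \<times> Y" using assms by simp
  have hi: "?h ?i = (\<tau>, y)" using assms by (simp add: G.m_assoc[symmetric])
  have P: "indexed_pmult p (\<tau>, y) \<in> PY Y" using assms by (intro indexed_pset.indexed_pmult) auto
  show "dpoly_act G R \<phi> Y \<sigma> (indexed_pmult p (\<tau>, y)) m =
    indexed_pmult (dpoly_act G R \<phi> Y \<sigma> p) ?i m"
  proof (cases "set_mset m \<subseteq> carrier G \<times> Y")
    case False
    then have "\<not> set_mset (m - {#?i#}) \<subseteq> carrier G \<times> Y" if "?i \<in># m"
      using i that by (metis insert_DiffM insert_subset set_mset_add_mset_insert)
    then show ?thesis
      using False assms P
      by (auto simp: dpoly_act_def carrier_dpoly_ring indexed_pmult_def)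
  next
    case True
    have mem: "(\<tau>, y) \<in># image_mset ?h m \<longleftrightarrow> ?i \<in># m"
    proof
      assume "(\<tau>, y) \<in># image_mset ?h m"
      then obtain \<rho> where \<rho>: "(\<rho>, y) \<in># m" "\<tau> = inv\<^bsub>G\<^esub> \<sigma> \<otimes>\<^bsub>G\<^esub> \<rho>" by auto
      then have "\<rho> \<in> carrier G" using True by auto
      then show "?i \<in># m" using \<rho> assms by (simp add: G.m_assoc[symmetric])
    next
      assume "?i \<in># m"
      then show "(\<tau>, y) \<in># image_mset ?h m" using hi by (metis image_eqI set_image_mset)
    qed
    have sub: "set_mset (m - {#?i#}) \<subseteq> carrier G \<times> Y"
      using True by (meson in_diffD subset_iff)
    have "image_mset ?h (m - {#?i#}) = image_mset ?h m - {#(\<tau>, y)#}" if "?i \<in># m"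
      using that hi by (simp add: image_mset_Diff)
    then show ?thesis
      using True assms P sub mem
      by (auto simp: dpoly_act_def carrier_dpoly_ring indexed_pmult_def act_zero)
  qed
qed

lemma dpoly_act_closed:
  assumes "\<sigma> \<in> carrier G" "p \<in> PY Y" shows "dpoly_act G R \<phi> Y \<sigma> p \<in> PY Y"
  using assms(2)
proof (induction rule: indexed_pset.induct)
  case (indexed_const k)
  have "indexed_const (\<phi> \<sigma> k) \<in> PY Y"
    by (rule indexed_pset.indexed_const) (use act_closed indexed_const assms in auto)
  then show ?case using indexed_const assms by (simp add: dpoly_act_const)
next
  case (indexed_padd p q)
  then show ?case using assms by (simp add: dpoly_act_padd indexed_pset.indexed_padd)
next
  case (indexed_pmult p i)
  interpret G: Group.group G by (rule group_G)
  from indexed_pmult obtain \<tau> y where i: "i = (\<tau>, y)" "\<tau> \<in> carrier G" "y \<in> Y" by auto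
  with indexed_pmult show ?case
    using assms by (simp add: dpoly_act_pmult indexed_pset.indexed_pmult)
qed

lemma dpoly_act_mult:
  assumes "\<sigma> \<in> carrier G" "p \<in> PY Y" "q \<in> PY Y"
  shows "dpoly_act G R \<phi> Y \<sigma> (mpoly_mult R p q) =
    mpoly_mult R (dpoly_act G R \<phi> Y \<sigma> p) (dpoly_act G R \<phi> Y \<sigma> q)"
  using assms(3)
proof (induction rule: indexed_pset.induct)
  case (indexed_const k)
  have "dpoly_act G R \<phi> Y \<sigma> (\<lambda>m. p m \<otimes> k) = (\<lambda>m. dpoly_act G R \<phi> Y \<sigma> p m \<otimes> \<phi> \<sigma> k)"
    using assms indexed_const cmul_pset[OF assms(2) indexed_const] indexed_pset_coeff[OF assms(2)]
    by (auto simp: dpoly_act_def carrier_dpoly_ring fun_eq_iff ring_hom_mult[OF act_hom] act_closed)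
  then show ?case
    using assms indexed_const
    by (simp add: mpoly_mult_const dpoly_act_const dpoly_act_closed act_closed
        pset_carrier_coeff[where V="carrier G \<times> Y"])
next
  case (indexed_padd q r)
  then show ?case
    using assms
    by (simp add: mpoly_mult_padd dpoly_act_padd dpoly_act_closed mpoly_mult_pset
        pset_carrier_coeff[where V="carrier G \<times> Y"])
next
  case (indexed_pmult q i)
  then obtain \<tau> y where i: "i = (\<tau>, y)" "\<tau> \<in> carrier G" "y \<in> Y" by auto
  with indexed_pmult show ?case
    using assms
    by (simp add: mpoly_mult_pmult dpoly_act_pmult dpoly_act_closed mpoly_mult_pset
        pset_carrier_coeff[where V="carrier G \<times> Y"])
qed

lemma difference_ring_dpoly_ring: "difference_ring G (dpoly_ring G R Y) (dpoly_act G R \<phi> Y)"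
proof (rule difference_ringI)
  interpret G: Group.group G by (rule group_G)
  show "cring (dpoly_ring G R Y)" "Group.group G"
    by (simp_all add: dpoly_ring_def cring_mpoly_ring G.group_axioms)
  show "dpoly_act G R \<phi> Y \<sigma> \<in> ring_hom (dpoly_ring G R Y) (dpoly_ring G R Y)"
    if \<sigma>: "\<sigma> \<in> carrier G" for \<sigma>
  proof (rule ring_hom_memI)
    show "dpoly_act G R \<phi> Y \<sigma> \<one>\<^bsub>dpoly_ring G R Y\<^esub> = \<one>\<^bsub>dpoly_ring G R Y\<^esub>"
      using \<sigma> by (simp add: dpoly_ring_def mpoly_ring_def dpoly_act_const ring_hom_one[OF act_hom])
  qed (use \<sigma> in \<open>simp_all add: dpoly_ring_def mpoly_ring_def dpoly_act_closed dpoly_act_padd dpoly_act_mult\<close>)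
  show "dpoly_act G R \<phi> Y \<sigma> \<in> extensional (carrier (dpoly_ring G R Y))" for \<sigma>
    by (simp add: dpoly_act_def)
  show "dpoly_act G R \<phi> Y \<one>\<^bsub>G\<^esub> p = p" if "p \<in> carrier (dpoly_ring G R Y)" for p
    using that unfolding carrier_dpoly_ring
  proof (induction rule: indexed_pset.induct)
    case (indexed_pmult p i)
    then obtain \<tau> y where "i = (\<tau>, y)" "\<tau> \<in> carrier G" "y \<in> Y" by auto
    with indexed_pmult show ?case by (simp add: dpoly_act_pmult)
  qed (simp_all add: dpoly_act_const dpoly_act_padd act_one)
  show "dpoly_act G R \<phi> Y (\<sigma> \<otimes>\<^bsub>G\<^esub> \<tau>) p = dpoly_act G R \<phi> Y \<sigma> (dpoly_act G R \<phi> Y \<tau> p)"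
    if "\<sigma> \<in> carrier G" "\<tau> \<in> carrier G" "p \<in> carrier (dpoly_ring G R Y)" for \<sigma> \<tau> p
    using that(3) unfolding carrier_dpoly_ring
  proof (induction rule: indexed_pset.induct)
    case (indexed_pmult p i)
    then obtain \<rho> y where "i = (\<rho>, y)" "\<rho> \<in> carrier G" "y \<in> Y" by auto
    with indexed_pmult that show ?case by (simp add: dpoly_act_pmult dpoly_act_closed G.m_assoc)
  qed (use that in \<open>simp_all add: dpoly_act_const dpoly_act_padd act_mult dpoly_act_closed act_closed\<close>)
qed

end


context
  fixes G :: "('g, 'w) monoid_scheme" and A :: "('a, 'm) ring_scheme" and \<phi>
    and B :: "('b, 'n) ring_scheme" and \<psi> and \<iota> :: "'a \<Rightarrow> 'b" and Y :: "'y set" and b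
  assumes A: "difference_ring G A \<phi>" and B: "difference_ring G B \<psi>"
    and \<iota>: "\<iota> \<in> difference_hom G A \<phi> B \<psi>" and b: "b \<in> Y \<rightarrow> carrier B"
begin

interpretation A: difference_ring G A \<phi> by (rule A)
interpretation B: difference_ring G B \<psi> by (rule B)
interpretation E: mpoly_eval_at A B \<iota> "carrier G \<times> Y" "\<lambda>(\<sigma>, y). \<psi> \<sigma> (b y)"
  by unfold_locales (use \<iota> b in \<open>auto simp: difference_hom_def intro!: B.act_closed\<close>)

lemma dpoly_eval_ring_hom: "dpoly_eval A B \<psi> \<iota> b \<in> ring_hom (dpoly_ring G A Y) B"
  using E.ev_ring_hom by (simp add: dpoly_eval_def dpoly_ring_def)

lemma dpoly_eval_act:
  assumes "\<sigma> \<in> carrier G" "p \<in> carrier (dpoly_ring G A Y)"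
  shows "dpoly_eval A B \<psi> \<iota> b (dpoly_act G A \<phi> Y \<sigma> p) = \<psi> \<sigma> (dpoly_eval A B \<psi> \<iota> b p)"
  using assms(2) unfolding dpoly_eval_def A.carrier_dpoly_ring
proof (induction rule: A.indexed_pset.induct)
  case (indexed_const k)
  then show ?case
    using assms(1) \<iota>
    by (simp add: A.dpoly_act_const E.ev_const A.act_closed difference_hom_def)
next
  case (indexed_padd p q)
  then show ?case
    using assms(1)
    by (simp add: A.dpoly_act_padd E.ev_padd A.dpoly_act_closed E.ev_closed ring_hom_add[OF B.act_hom])
next
  case (indexed_pmult p i)
  interpret G: Group.group G by (rule A.group_G)
  from indexed_pmult obtain \<tau> y where i: "i = (\<tau>, y)" "\<tau> \<in> carrier G" "y \<in> Y" by auto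
  then have "b y \<in> carrier B" using b by auto
  with indexed_pmult i show ?case
    using assms(1)
    by (simp add: A.dpoly_act_pmult E.ev_pmult A.dpoly_act_closed E.ev_closed B.act_mult
        B.act_closed ring_hom_mult[OF B.act_hom])
qed

lemma dpoly_eval_const:
  "c \<in> carrier A \<Longrightarrow> dpoly_eval A B \<psi> \<iota> b (ring.indexed_const A c) = \<iota> c"
  by (simp add: dpoly_eval_def E.ev_const)

lemma dpoly_eval_var:
  assumes "y \<in> Y"
  shows "dpoly_eval A B \<psi> \<iota> b (ring.indexed_var A (\<one>\<^bsub>G\<^esub>, y)) = b y"
    "ring.indexed_var A (\<one>\<^bsub>G\<^esub>, y) \<in> carrier (dpoly_ring G A Y)"
proof -
  interpret G: Group.group G by (rule A.group_G)
  have 1: "A.indexed_const \<one>\<^bsub>A\<^esub> \<in> A.PY Y"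
    by (intro A.indexed_pset.indexed_const) simp
  show "dpoly_eval A B \<psi> \<iota> b (ring.indexed_var A (\<one>\<^bsub>G\<^esub>, y)) = b y"
    using assms b 1 by (auto simp: dpoly_eval_def A.indexed_var_def E.ev_pmult E.ev_const
        B.act_one ring_hom_one[OF E.hom] Pi_iff)
  show "ring.indexed_var A (\<one>\<^bsub>G\<^esub>, y) \<in> carrier (dpoly_ring G A Y)"
    unfolding A.carrier_dpoly_ring A.indexed_var_def
    using 1 assms by (intro A.indexed_pset.indexed_pmult) auto
qed

lemma dpoly_eval_hom_comp:
  fixes C :: "('c, 'l) ring_scheme"
  assumes C: "difference_ring G C \<psi>'" and S: "dpoly_eval A B \<psi> \<iota> b ` carrier (dpoly_ring G A Y) \<subseteq> S"
    and f: "f \<in> ring_hom (B\<lparr>carrier := S\<rparr>) C"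
    and f\<psi>: "\<And>\<sigma> s. \<sigma> \<in> carrier G \<Longrightarrow> s \<in> S \<Longrightarrow> f (\<psi> \<sigma> s) = \<psi>' \<sigma> (f s)"
    and p: "p \<in> carrier (dpoly_ring G A Y)"
  shows "dpoly_eval A C \<psi>' (f \<circ> \<iota>) (f \<circ> b) p = f (dpoly_eval A B \<psi> \<iota> b p)"
proof -
  interpret C: difference_ring G C \<psi>' by (rule C)
  interpret G: Group.group G by (rule A.group_G)
  have f_closed: "f x \<in> carrier C" if "x \<in> S" for x
    using ring_hom_closed[OF f] that by simp
  have f_hom: "f (x \<oplus>\<^bsub>B\<^esub> y) = f x \<oplus>\<^bsub>C\<^esub> f y" "f (x \<otimes>\<^bsub>B\<^esub> y) = f x \<otimes>\<^bsub>C\<^esub> f y"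
    if "x \<in> S" "y \<in> S" for x y
    using ring_hom_add[OF f] ring_hom_mult[OF f] that by auto
  have f_one: "f \<one>\<^bsub>B\<^esub> = \<one>\<^bsub>C\<^esub>" using ring_hom_one[OF f] by simp
  note f_simps = f_closed f_hom f_one
  have evS: "E.ev p \<in> S" if "p \<in> A.PY Y" for p
    using S that by (auto simp: dpoly_eval_def A.carrier_dpoly_ring)
  have \<iota>S: "\<iota> c \<in> S" if "c \<in> carrier A" for c
    using evS[of "A.indexed_const c"] that by (simp add: E.ev_const A.indexed_pset.indexed_const)
  have bS: "b y \<in> S" if "y \<in> Y" for y
    using S dpoly_eval_var[OF that] by (metis imageI subsetD)
  have \<psi>S: "\<psi> \<sigma> (b y) \<in> S" if "\<sigma> \<in> carrier G" "y \<in> Y" for \<sigma> y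
  proof -
    have "dpoly_act G A \<phi> Y \<sigma> (A.indexed_var (\<one>\<^bsub>G\<^esub>, y)) \<in> carrier (dpoly_ring G A Y)"
      using A.dpoly_act_closed that dpoly_eval_var(2) by (metis A.carrier_dpoly_ring)
    moreover have "dpoly_eval A B \<psi> \<iota> b (dpoly_act G A \<phi> Y \<sigma> (A.indexed_var (\<one>\<^bsub>G\<^esub>, y))) = \<psi> \<sigma> (b y)"
      using that by (simp add: dpoly_eval_act dpoly_eval_var)
    ultimately show ?thesis using S by (metis imageI subsetD)
  qed
  define \<iota>' where "\<iota>' = f \<circ> \<iota>"
  define val' where "val' = (\<lambda>(\<sigma>, y). \<psi>' \<sigma> ((f \<circ> b) y))"
  have \<iota>': "\<iota>' c = f (\<iota> c)" and val': "val' (\<sigma>, y) = \<psi>' \<sigma> (f (b y))" for c \<sigma> y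
    by (simp_all add: \<iota>'_def val'_def)
  have hom: "\<iota>' \<in> ring_hom A C"
    using E.hom f_simps \<iota>S
    by (intro ring_hom_memI) (simp_all add: \<iota>' ring_hom_add ring_hom_mult ring_hom_one)
  interpret F: mpoly_eval_at A C \<iota>' "carrier G \<times> Y" val'
    by unfold_locales (use hom bS f_closed in \<open>auto simp: val' intro!: C.act_closed\<close>)
  have "F.ev p = f (E.ev p)"
    using p unfolding A.carrier_dpoly_ring
  proof (induction rule: A.indexed_pset.induct)
    case (indexed_const k)
    show ?case unfolding F.ev_const[OF indexed_const] E.ev_const[OF indexed_const] by (rule \<iota>')
  next
    case (indexed_pmult p i)
    then obtain \<tau> y where i: "i = (\<tau>, y)" "\<tau> \<in> carrier G" "y \<in> Y" by auto
    then show ?case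
      using indexed_pmult evS \<psi>S bS f\<psi>
      by (simp add: F.ev_pmult E.ev_pmult f_simps val')
  qed (simp add: F.ev_padd E.ev_padd f_simps evS)
  then show ?thesis by (simp only: dpoly_eval_def \<iota>'_def val'_def)
qed

end

text \<open>The type of sets of difference polynomials accommodates every extension up to restriction
  to a difference subring containing the zero.\<close>

theorem zeros_from_extensions_all_types:
  fixes G :: "('g, 'w) monoid_scheme" and A :: "('a, 'm) ring_scheme"
  assumes A: "difference_ring G A \<phi>"
    and univ: "zeros_from_extensions TYPE((('g \<times> nat) multiset \<Rightarrow> 'a) set) G A \<phi>"
  shows "zeros_from_extensions TYPE('b) G A \<phi>"
  unfolding zeros_from_extensions_def
proof (intro allI impI)
  fix n :: nat and E
  assume E: "E \<subseteq> carrier (dpoly_ring G A {1..n})"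
  assume "\<exists>(B :: 'b ring) \<psi> \<iota> b. difference_domain G B \<psi> \<and>
    \<iota> \<in> difference_hom G A \<phi> B \<psi> \<and> inj_on \<iota> (carrier A) \<and> common_zero A B \<psi> \<iota> {1..n} E b"
  then obtain B :: "'b ring" and \<psi> \<iota> b where B: "difference_domain G B \<psi>"
    and \<iota>: "\<iota> \<in> difference_hom G A \<phi> B \<psi>" and inj: "inj_on \<iota> (carrier A)"
    and zero: "common_zero A B \<psi> \<iota> {1..n} E b" by blast
  let ?Y = "{1..n}" and ?R = "dpoly_ring G A {1..n}"
  define ev where "ev = dpoly_eval A B \<psi> \<iota> b"
  define S where "S = ev ` carrier ?R"
  interpret A: difference_ring G A \<phi> by fact
  interpret B: difference_domain G B \<psi> by fact
  interpret G: Group.group G by (rule A.group_G)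
  interpret R: difference_ring G ?R "dpoly_act G A \<phi> ?Y" by (rule A.difference_ring_dpoly_ring)
  have b: "b \<in> ?Y \<rightarrow> carrier B" using zero by (simp add: common_zero_def)
  note facts = A B.difference_ring_axioms \<iota> b
  have ev: "ev \<in> ring_hom ?R B" unfolding ev_def by (rule dpoly_eval_ring_hom[OF facts])
  then interpret ev: ring_hom_ring ?R B ev
    by (intro ring_hom_ringI2 R.ring_axioms B.ring_axioms)
  have S_sub: "S \<subseteq> carrier B" unfolding S_def by auto
  have "subring S B" unfolding S_def using ev.img_is_subring[OF R.carrier_is_subring] .
  then have D: "domain (B\<lparr>carrier := S\<rparr>)" (is "domain ?D")
    by (rule B.subring_is_domain)
  interpret D: domain ?D by fact
  have S\<psi>: "\<psi> \<sigma> s \<in> S" if "\<sigma> \<in> carrier G" "s \<in> S" for \<sigma> s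
  proof -
    obtain p where p: "p \<in> carrier ?R" "s = ev p" using \<open>s \<in> S\<close> unfolding S_def by blast
    have "\<psi> \<sigma> s = ev (dpoly_act G A \<phi> ?Y \<sigma> p)"
      unfolding p(2) ev_def by (rule dpoly_eval_act[OF facts that(1) p(1), symmetric])
    then show ?thesis unfolding S_def using R.act_closed[OF that(1) p(1)] by blast
  qed
  define f where "f s = {p \<in> carrier ?R. ev p = s}" for s
  have f_inj: "inj_on f S"
  proof (rule inj_onI)
    fix s t assume "s \<in> S" "t \<in> S" "f s = f t"
    then obtain p where "p \<in> carrier ?R" "s = ev p" unfolding S_def by blast
    then have "p \<in> f t" using \<open>f s = f t\<close> unfolding f_def by blast
    then show "s = t" using \<open>s = ev p\<close> by (simp add: f_def)
  qed
  define C where "C = image_ring f ?D"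
  define \<psi>' where "\<psi>' \<sigma> = (\<lambda>c\<in>carrier C. f (\<psi> \<sigma> (inv_into S f c)))" for \<sigma>
  have f_iso: "f \<in> ring_iso ?D C"
    unfolding C_def by (rule inj_imp_image_ring_iso) (simp add: f_inj)
  then have f_hom: "f \<in> ring_hom ?D C" by (simp add: ring_iso_def)
  have C: "domain C" unfolding C_def by (rule D.inj_imp_image_ring_is_domain) (simp add: f_inj)
  interpret C: domain C by fact
  have carrier_C: "carrier C = f ` S" by (simp add: C_def image_ring_carrier)
  have \<psi>'_f: "\<psi>' \<sigma> (f s) = f (\<psi> \<sigma> s)" if "s \<in> S" for \<sigma> s
    using that by (simp add: \<psi>'_def carrier_C inv_into_f_f[OF f_inj])
  have fadd: "f s \<oplus>\<^bsub>C\<^esub> f t = f (s \<oplus>\<^bsub>B\<^esub> t)" and fmult: "f s \<otimes>\<^bsub>C\<^esub> f t = f (s \<otimes>\<^bsub>B\<^esub> t)"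
    if "s \<in> S" "t \<in> S" for s t
    using ring_hom_add[OF f_hom, of s t] ring_hom_mult[OF f_hom, of s t] that by simp_all
  have fone: "f \<one>\<^bsub>B\<^esub> = \<one>\<^bsub>C\<^esub>" using ring_hom_one[OF f_hom] by simp
  have fzero: "f \<zero>\<^bsub>B\<^esub> = \<zero>\<^bsub>C\<^esub>" using ring_hom_zero[OF f_hom D.ring_axioms C.ring_axioms] by simp
  have S_closed: "s \<oplus>\<^bsub>B\<^esub> t \<in> S" "s \<otimes>\<^bsub>B\<^esub> t \<in> S" "\<one>\<^bsub>B\<^esub> \<in> S" if "s \<in> S" "t \<in> S" for s t
    using D.a_closed[of s t] D.m_closed[of s t] D.one_closed that by simp_all
  have "\<one>\<^bsub>B\<^esub> \<in> S" using D.one_closed by simp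
  have dC: "difference_ring G C \<psi>'"
  proof (rule difference_ringI)
    show "cring C" "Group.group G" by (rule C.cring_axioms, rule G.group_axioms)
    fix \<sigma> assume \<sigma>: "\<sigma> \<in> carrier G"
    have h: "\<psi> \<sigma> \<in> ring_hom B B" using \<sigma> by (rule B.act_hom)
    show "\<psi>' \<sigma> \<in> ring_hom C C"
    proof (rule ring_hom_memI)
      fix x y assume "x \<in> carrier C" "y \<in> carrier C"
      then obtain s t where st: "s \<in> S" "x = f s" "t \<in> S" "y = f t" unfolding carrier_C by blast
      then have "s \<in> carrier B" "t \<in> carrier B" using S_sub by auto
      then show "\<psi>' \<sigma> (x \<oplus>\<^bsub>C\<^esub> y) = \<psi>' \<sigma> x \<oplus>\<^bsub>C\<^esub> \<psi>' \<sigma> y"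
        "\<psi>' \<sigma> (x \<otimes>\<^bsub>C\<^esub> y) = \<psi>' \<sigma> x \<otimes>\<^bsub>C\<^esub> \<psi>' \<sigma> y"
        using st \<sigma> by (simp_all add: fadd fmult \<psi>'_f S\<psi> S_closed ring_hom_add[OF h] ring_hom_mult[OF h])
      show "\<psi>' \<sigma> x \<in> carrier C" using st \<sigma> by (simp add: \<psi>'_f S\<psi> carrier_C)
    next
      show "\<psi>' \<sigma> \<one>\<^bsub>C\<^esub> = \<one>\<^bsub>C\<^esub>"
        using \<psi>'_f[OF \<open>\<one>\<^bsub>B\<^esub> \<in> S\<close>, of \<sigma>] ring_hom_one[OF h] fone by simp
    qed
    show "\<psi>' \<sigma> \<in> extensional (carrier C)" by (simp add: \<psi>'_def)
    fix \<tau> x assume "\<tau> \<in> carrier G" "x \<in> carrier C"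
    then obtain s where s: "s \<in> S" "x = f s" unfolding carrier_C by blast
    then show "\<psi>' (\<sigma> \<otimes>\<^bsub>G\<^esub> \<tau>) x = \<psi>' \<sigma> (\<psi>' \<tau> x)"
      using S_sub \<sigma> \<open>\<tau> \<in> carrier G\<close> by (auto simp: \<psi>'_f S\<psi> B.act_mult)
  next
    fix x assume "x \<in> carrier C"
    then obtain s where s: "s \<in> S" "x = f s" unfolding carrier_C by blast
    then show "\<psi>' \<one>\<^bsub>G\<^esub> x = x" using S_sub by (auto simp: \<psi>'_f B.act_one)
  qed
  have \<iota>S: "\<iota> c \<in> S" if "c \<in> carrier A" for c
  proof -
    have "A.indexed_const c \<in> carrier ?R"
      using that by (simp add: A.carrier_dpoly_ring A.indexed_pset.indexed_const)
    moreover have "ev (A.indexed_const c) = \<iota> c"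
      unfolding ev_def by (rule dpoly_eval_const[OF facts that])
    ultimately show ?thesis unfolding S_def by (metis imageI)
  qed
  have bS: "b y \<in> S" if "y \<in> ?Y" for y
    unfolding S_def using dpoly_eval_var[OF facts that] by (metis ev_def imageI)
  have \<iota>_hom: "\<iota> \<in> ring_hom A B" using \<iota> by (simp add: difference_hom_def)
  have "difference_domain G C \<psi>'"
    by (simp add: difference_domain_def dC C.domain_axioms)
  moreover have "f \<circ> \<iota> \<in> difference_hom G A \<phi> C \<psi>'"
  proof -
    have "f \<circ> \<iota> \<in> ring_hom A C"
      by (rule ring_hom_memI)
        (simp_all add: carrier_C \<iota>S fadd fmult fone ring_hom_add[OF \<iota>_hom] ring_hom_mult[OF \<iota>_hom]
          ring_hom_one[OF \<iota>_hom])
    then show ?thesis using \<iota> by (auto simp: difference_hom_def \<psi>'_f \<iota>S)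
  qed
  moreover have "inj_on (f \<circ> \<iota>) (carrier A)"
    by (rule comp_inj_on[OF inj]) (rule inj_on_subset[OF f_inj], use \<iota>S in auto)
  moreover have "common_zero A C \<psi>' (f \<circ> \<iota>) ?Y E (f \<circ> b)"
    unfolding common_zero_def
  proof (intro conjI ballI)
    show "f \<circ> b \<in> ?Y \<rightarrow> carrier C" using bS by (auto simp: carrier_C)
    fix p assume "p \<in> E"
    then have p: "p \<in> carrier ?R" using E by blast
    have "dpoly_eval A C \<psi>' (f \<circ> \<iota>) (f \<circ> b) p = f (dpoly_eval A B \<psi> \<iota> b p)"
      by (rule dpoly_eval_hom_comp[OF facts dC _ f_hom _ p])
        (simp_all only: S_def ev_def subset_refl \<psi>'_f)
    then show "dpoly_eval A C \<psi>' (f \<circ> \<iota>) (f \<circ> b) p = \<zero>\<^bsub>C\<^esub>"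
      using zero \<open>p \<in> E\<close> fzero by (simp add: common_zero_def)
  qed
  ultimately show "\<exists>a. common_zero A A \<phi> (\<lambda>x. x) ?Y E a"
    using univ E unfolding zeros_from_extensions_def by blast
qed

end

theory Submission
  imports Defs "HOL-Algebra.Algebraic_Closure"
begin

text \<open>A proper perfect difference ideal lies in a prime difference ideal, and the polynomials
  vanishing at a point of a difference domain form a prime difference ideal. So a difference field
  \<open>M\<close> is difference closed once every prime difference ideal \<open>P\<close> of \<open>M{y\<^sub>1,\<dots>,y\<^sub>n}\<close> has a
  zero in \<open>M\<close>. A zero always exists in the fraction field of \<open>M{y\<^sub>1,\<dots>,y\<^sub>n}/P\<close>, but
  iterating needs care: extensions of \<open>M\<close> need not amalgamate, and the process must stop within a
  fixed type.

  Both problems are solved by naming elements. As a vector space, \<open>P\<close> is spanned by a family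
  \<open>E\<close> indexed by monomials, and the host type \<open>U\<close> has an injection taking each tuple
  \<open>(n, E, f, g)\<close> of a number and families of elements of \<open>U\<close> indexed by monomials or pairs of
  monomials to an element of \<open>U\<close>. The new elements \<open>f/g\<close> of the fraction field receive the
  names \<open>(n, E, f, g)\<close>. Consider the difference fields with carrier in \<open>U\<close> that extend (a copy
  of) \<open>K\<close> and contain a name \<open>(n, E, f, g)\<close> only if the system \<open>E\<close> has a zero in them. These
  are closed under unions of chains. If \<open>P\<close> has no zero in such a field \<open>M\<close>, then the names for
  \<open>P\<close> are not in \<open>M\<close>, so the fraction field can be realised inside \<open>U\<close> as an extension of \<open>M\<close>
  of the same kind. Hence a maximal such field is difference closed.\<close>

section \<open>Prime difference ideals\<close>

lemma perfect_difference_idealD: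
  fixes \<tau> :: "nat \<Rightarrow> 'g" and k :: "nat \<Rightarrow> nat"
  assumes "perfect_difference_ideal G R \<phi> I" "a \<in> carrier R" "r \<ge> 1"
    and "\<And>i. i \<in> {1..r} \<Longrightarrow> \<tau> i \<in> carrier G \<and> k i > 0"
    and "(\<Otimes>\<^bsub>R\<^esub>i\<in>{1..r}. \<phi> (\<tau> i) a [^]\<^bsub>R\<^esub> k i) \<in> I"
  shows "a \<in> I"
proof -
  have "\<forall>i\<in>{1..r}. \<tau> i \<in> carrier G \<and> k i > 0" using assms(4) by blast
  then show ?thesis using assms(1-3,5) unfolding perfect_difference_ideal_def by blast
qed

text \<open>For \<open>c = \<phi> g x \<otimes> y\<close>, the product of \<open>c\<close> with its
  translate by the inverse of \<open>g\<close> is a multiple of \<open>x \<otimes> y\<close>. It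
  therefore lies in \<open>M\<close>, and perfectness gives \<open>c \<in> M\<close>.\<close>

lemma (in difference_ring) perfect_difference_ideal_shift:
  assumes M: "perfect_difference_ideal G R \<phi> M" and xy: "x \<in> carrier R" "y \<in> carrier R" "x \<otimes> y \<in> M"
    and g: "g \<in> carrier G"
  shows "\<phi> g x \<otimes> y \<in> M"
proof -
  interpret G: Group.group G by (rule group_G)
  interpret M: ideal M R using M by (simp add: perfect_difference_ideal_def difference_ideal_def)
  let ?c = "\<phi> g x \<otimes> y" and ?\<tau> = "\<lambda>i :: nat. if i = 1 then \<one>\<^bsub>G\<^esub> else inv\<^bsub>G\<^esub> g"
  have closed: "\<phi> g x \<in> carrier R" "\<phi> (inv\<^bsub>G\<^esub> g) y \<in> carrier R" "?c \<in> carrier R"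
    using xy g by (simp_all add: act_closed)
  have inv: "\<phi> (inv\<^bsub>G\<^esub> g) ?c = x \<otimes> \<phi> (inv\<^bsub>G\<^esub> g) y"
    using xy g closed by (simp add: ring_hom_mult[OF act_hom] act_mult[symmetric] act_one)
  have "{1..2 :: nat} = {1, 2}" by auto
  then have "(\<Otimes>i\<in>{1..2}. \<phi> (?\<tau> i) ?c [^] (1 :: nat)) = ?c \<otimes> (x \<otimes> \<phi> (inv\<^bsub>G\<^esub> g) y)"
    using xy g closed by (simp add: act_one inv)
  also have "\<dots> = (x \<otimes> y) \<otimes> (\<phi> g x \<otimes> \<phi> (inv\<^bsub>G\<^esub> g) y)"
    using xy closed by (simp add: m_ac)
  also have "\<dots> \<in> M" using xy closed by (simp add: M.I_r_closed)
  finally have mem: "(\<Otimes>i\<in>{1..2}. \<phi> (?\<tau> i) ?c [^] (1 :: nat)) \<in> M" .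
  show ?thesis
    by (rule perfect_difference_idealD[OF M closed(3) _ _ mem]) (use g in auto)
qed

text \<open>Invariance under the action is the shift of \<open>x \<otimes> a\<close>. For
  perfectness, let the test product \<open>Z\<close> of \<open>b\<close> satisfy
  \<open>a \<otimes> Z \<in> M\<close>. The test product of \<open>a \<otimes> b\<close> is
  \<open>Y \<otimes> Z\<close>, and a translate of \<open>a\<close> divides \<open>Y\<close>, so the
  shift puts it in \<open>M\<close>.\<close>

lemma (in difference_ring) perfect_difference_ideal_colon:
  assumes M: "perfect_difference_ideal G R \<phi> M" and a: "a \<in> carrier R"
  shows "perfect_difference_ideal G R \<phi> {x \<in> carrier R. a \<otimes> x \<in> M}"
    (is "perfect_difference_ideal G R \<phi> ?J")
proof -
  interpret M: ideal M R using M by (simp add: perfect_difference_ideal_def difference_ideal_def)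
  have "ideal ?J R" using M.helper_max_prime[OF is_cring a] .
  moreover have "\<phi> g x \<in> ?J" if "g \<in> carrier G" "x \<in> ?J" for g x
    using perfect_difference_ideal_shift[OF M, of x a g] that a by (simp add: act_closed m_comm)
  moreover have "b \<in> ?J"
    if b: "b \<in> carrier R" and r: "r \<ge> 1" and \<tau>: "\<forall>i\<in>{1..r}. \<tau> i \<in> carrier G \<and> k i > 0"
      and mem: "(\<Otimes>i\<in>{1..r}. \<phi> (\<tau> i) b [^] k i) \<in> ?J"
    for b r and \<tau> :: "nat \<Rightarrow> 'g" and k :: "nat \<Rightarrow> nat"
  proof -
    define Z where "Z = (\<Otimes>i\<in>{1..r}. \<phi> (\<tau> i) b [^] k i)"
    define Y where "Y = (\<Otimes>i\<in>{1..r}. \<phi> (\<tau> i) a [^] k i)"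
    define W where "W = (\<Otimes>i\<in>{1..r} - {1}. \<phi> (\<tau> i) a [^] k i)"
    have Z: "Z \<in> carrier R" "a \<otimes> Z \<in> M" using mem by (simp_all add: Z_def)
    have act: "\<phi> (\<tau> i) x \<in> carrier R" if "i \<in> {1..r}" "x \<in> carrier R" for i x
      using that \<tau> by (blast intro: act_closed)
    have 1: "1 \<in> {1..r}" using r by simp
    have W: "W \<in> carrier R" unfolding W_def by (rule finprod_closed) (use act a in auto)
    have "Y = \<phi> (\<tau> 1) a [^] k 1 \<otimes> W"
    proof -
      have "{1..r} = insert 1 ({1..r} - {1})" using 1 by blast
      then have "Y = (\<Otimes>i\<in>insert 1 ({1..r} - {1}). \<phi> (\<tau> i) a [^] k i)" by (simp add: Y_def)
      also have "\<dots> = \<phi> (\<tau> 1) a [^] k 1 \<otimes> W"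
        unfolding W_def by (rule finprod_insert) (use act a 1 in auto)
      finally show ?thesis .
    qed
    \<comment> \<open>Positivity of \<open>k 1\<close> splits off one factor
      \<open>\<phi> (\<tau> 1) a\<close>, which the shift pairs with \<open>Z\<close>.\<close>
    moreover obtain l where "k 1 = Suc l" using \<tau> 1 gr0_implies_Suc by blast
    ultimately have Y: "Y = \<phi> (\<tau> 1) a [^] l \<otimes> \<phi> (\<tau> 1) a \<otimes> W" by simp
    have "(\<Otimes>i\<in>{1..r}. \<phi> (\<tau> i) (a \<otimes> b) [^] k i) =
      (\<Otimes>i\<in>{1..r}. \<phi> (\<tau> i) a [^] k i \<otimes> \<phi> (\<tau> i) b [^] k i)"
      by (rule finprod_cong')
        (use \<tau> a b act in \<open>auto simp: ring_hom_mult[OF act_hom] nat_pow_distrib\<close>)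
    also have "\<dots> = Y \<otimes> Z"
      unfolding Y_def Z_def by (rule finprod_multf) (use act a b in auto)
    also have "\<dots> = (\<phi> (\<tau> 1) a \<otimes> Z) \<otimes> (\<phi> (\<tau> 1) a [^] l \<otimes> W)"
      using act[OF 1 a] W Z(1) by (simp add: Y m_ac)
    also have "\<dots> \<in> M"
      using perfect_difference_ideal_shift[OF M a Z] \<tau> 1 act[OF 1 a] W by (simp add: M.I_r_closed)
    finally have *: "(\<Otimes>i\<in>{1..r}. \<phi> (\<tau> i) (a \<otimes> b) [^] k i) \<in> M" .
    have "a \<otimes> b \<in> M"
      by (rule perfect_difference_idealD[OF M _ r _ *]) (use \<tau> a b in auto)
    then show ?thesis using b by simp
  qed
  ultimately show ?thesis
    unfolding perfect_difference_ideal_def difference_ideal_def by blast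
qed

text \<open>An ideal \<open>M\<close> maximal among the proper perfect ideals is prime, since for \<open>a \<notin> M\<close> the
  proper perfect ideal \<open>(M : a)\<close> contains \<open>M\<close>.\<close>

lemma (in difference_ring) perfect_difference_ideal_in_prime:
  assumes I: "perfect_difference_ideal G R \<phi> I" and proper: "I \<noteq> carrier R"
  obtains P where "primeideal P R" "difference_ideal G R \<phi> P" "I \<subseteq> P"
proof -
  \<comment> \<open>Properness is expressed by \<open>\<one> \<notin> J\<close>, a condition that
    passes to unions of chains.\<close>
  define F where "F = {J. perfect_difference_ideal G R \<phi> J \<and> I \<subseteq> J \<and> \<one> \<notin> J}"
  have ideal: "ideal J R" if "J \<in> F" for J
    using that by (simp add: F_def perfect_difference_ideal_def difference_ideal_def)
  have "I \<in> F"
    using I proper ideal.one_imp_carrier[of I R]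
    by (auto simp: F_def perfect_difference_ideal_def difference_ideal_def)
  have "\<exists>M\<in>F. \<forall>N\<in>F. M \<subseteq> N \<longrightarrow> N = M"
  proof (rule subset_Zorn_nonempty)
    show "F \<noteq> {}" using \<open>I \<in> F\<close> by blast
    fix C assume "C \<noteq> {}" and C: "subset.chain F C"
    then have CF: "C \<subseteq> F" by (simp add: subset.chain_def)
    have "subset.chain {J. ideal J R} C"
      using C ideal by (auto simp: subset.chain_def)
    then have "ideal (if C = {} then {\<zero>} else \<Union>C) R" by (rule chain_Union_is_ideal)
    then have "ideal (\<Union>C) R" using \<open>C \<noteq> {}\<close> by simp
    moreover have "\<phi> g ` \<Union>C \<subseteq> \<Union>C" if "g \<in> carrier G" for g
      using CF that unfolding F_def perfect_difference_ideal_def difference_ideal_def by blast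
    moreover have "a \<in> \<Union>C"
      if ar: "a \<in> carrier R" "r \<ge> 1" "\<forall>i\<in>{1..r}. \<tau> i \<in> carrier G \<and> k i > 0"
        and mem: "(\<Otimes>i\<in>{1..r}. \<phi> (\<tau> i) a [^] k i) \<in> \<Union>C"
      for a r and \<tau> :: "nat \<Rightarrow> 'g" and k :: "nat \<Rightarrow> nat"
    proof -
      \<comment> \<open>The perfectness condition tests membership of a single product, so it can be
        applied inside one member of the chain.\<close>
      obtain J where J: "J \<in> C" "(\<Otimes>i\<in>{1..r}. \<phi> (\<tau> i) a [^] k i) \<in> J" using mem by blast
      then have "perfect_difference_ideal G R \<phi> J" using CF by (auto simp: F_def)
      then have "a \<in> J"
        by (rule perfect_difference_idealD[of G R \<phi> J a r \<tau> k]) (use ar J(2) in blast)+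
      then show ?thesis using J(1) by blast
    qed
    ultimately have "perfect_difference_ideal G R \<phi> (\<Union>C)"
      unfolding perfect_difference_ideal_def difference_ideal_def by blast
    then show "\<Union>C \<in> F" using CF \<open>C \<noteq> {}\<close> by (auto simp: F_def)
  qed
  then obtain M where M: "M \<in> F" and max: "\<And>N. N \<in> F \<Longrightarrow> M \<subseteq> N \<Longrightarrow> N = M" by blast
  interpret M: ideal M R using M by (rule ideal)
  have perf: "perfect_difference_ideal G R \<phi> M" and "I \<subseteq> M" "\<one> \<notin> M" using M by (auto simp: F_def)
  have "primeideal M R"
  proof (rule primeidealI[OF M.is_ideal is_cring])
    show "carrier R \<noteq> M" using \<open>\<one> \<notin> M\<close> one_closed by metis
    fix a b assume ab: "a \<in> carrier R" "b \<in> carrier R" "a \<otimes> b \<in> M"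
    show "a \<in> M \<or> b \<in> M"
    proof (cases "a \<in> M")
      case False
      let ?J = "{x \<in> carrier R. a \<otimes> x \<in> M}"
      have "M \<subseteq> ?J" using ab M.Icarr by (auto intro: M.I_l_closed)
      moreover have "\<one> \<notin> ?J" using False ab by simp
      ultimately have "?J \<in> F"
        using perfect_difference_ideal_colon[OF perf ab(1)] \<open>I \<subseteq> M\<close> by (auto simp: F_def)
      then have "?J = M" using \<open>M \<subseteq> ?J\<close> by (rule max)
      then show ?thesis using ab by blast
    qed simp
  qed
  moreover have "difference_ideal G R \<phi> M" using perf by (simp add: perfect_difference_ideal_def)
  ultimately show thesis using \<open>I \<subseteq> M\<close> that by blast
qed

section \<open>Images and quotients of difference rings\<close>

lemma difference_hom_comp:
  assumes "f \<in> difference_hom G R \<phi> S \<psi>" "g \<in> difference_hom G S \<psi> T \<chi>"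
  shows "g \<circ> f \<in> difference_hom G R \<phi> T \<chi>"
  using assms ring_hom_trans[of f R S g T] by (auto simp: difference_hom_def ring_hom_closed)

lemma difference_hom_cong:
  assumes "f \<in> difference_hom G R \<phi> S \<psi>" "difference_ring G R \<phi>"
    and eq: "\<And>x. x \<in> carrier R \<Longrightarrow> g x = f x"
  shows "g \<in> difference_hom G R \<phi> S \<psi>"
proof -
  interpret difference_ring G R \<phi> by fact
  have "g \<in> ring_hom R S"
    using assms(1) eq ring_hom_restrict[of f S g] by (auto simp: difference_hom_def)
  then show ?thesis using assms(1) eq by (auto simp: difference_hom_def act_closed)
qed

text \<open>Choosing preimages under the surjection \<open>f\<close> defines the action on
  \<open>S\<close>, and \<open>compat\<close> makes the result independent of the choice. Relabelled
  copies and quotients both get their action from here.\<close>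

lemma (in difference_ring) action_descends:
  assumes S: "cring S" and f: "f \<in> ring_hom R S" "f ` carrier R = carrier S"
    and compat: "\<And>g x y. g \<in> carrier G \<Longrightarrow> x \<in> carrier R \<Longrightarrow> y \<in> carrier R \<Longrightarrow> f x = f y \<Longrightarrow>
      f (\<phi> g x) = f (\<phi> g y)"
  obtains \<psi> where "difference_ring G S \<psi>" "f \<in> difference_hom G R \<phi> S \<psi>"
proof -
  interpret G: Group.group G by (rule group_G)
  interpret S: cring S by fact
  define \<psi> where "\<psi> g = (\<lambda>s\<in>carrier S. f (\<phi> g (inv_into (carrier R) f s)))" for g
  have \<psi>: "\<psi> g (f x) = f (\<phi> g x)" if "g \<in> carrier G" "x \<in> carrier R" for g x
  proof -
    have "f x \<in> f ` carrier R" using that by blast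
    then have "f (\<phi> g (inv_into (carrier R) f (f x))) = f (\<phi> g x)"
      by (intro compat that inv_into_into f_inv_into_f)
    then show ?thesis using ring_hom_closed[OF f(1) that(2)] by (simp add: \<psi>_def)
  qed
  have surj: "\<exists>x\<in>carrier R. s = f x" if "s \<in> carrier S" for s using that f(2) by blast
  note simps = \<psi> act_closed ring_hom_closed[OF f(1)]
  have "difference_ring G S \<psi>"
  proof (rule difference_ringI)
    fix g assume g: "g \<in> carrier G"
    show "\<psi> g \<in> ring_hom S S"
    proof (rule ring_hom_memI)
      fix s t assume "s \<in> carrier S" "t \<in> carrier S"
      then obtain x y where xy: "x \<in> carrier R" "y \<in> carrier R" "s = f x" "t = f y" using surj by metis
      then show "\<psi> g s \<in> carrier S" using g by (simp add: simps)
      show "\<psi> g (s \<otimes>\<^bsub>S\<^esub> t) = \<psi> g s \<otimes>\<^bsub>S\<^esub> \<psi> g t"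
        using xy g by (simp add: simps ring_hom_mult[OF f(1), symmetric] ring_hom_mult[OF act_hom])
      show "\<psi> g (s \<oplus>\<^bsub>S\<^esub> t) = \<psi> g s \<oplus>\<^bsub>S\<^esub> \<psi> g t"
        using xy g by (simp add: simps ring_hom_add[OF f(1), symmetric] ring_hom_add[OF act_hom])
    next
      show "\<psi> g \<one>\<^bsub>S\<^esub> = \<one>\<^bsub>S\<^esub>"
        using \<psi>[OF g one_closed] g by (simp add: ring_hom_one[OF f(1)] ring_hom_one[OF act_hom])
    qed
    show "\<psi> g \<in> extensional (carrier S)" by (simp add: \<psi>_def)
    fix h s assume "h \<in> carrier G" "s \<in> carrier S"
    then show "\<psi> (g \<otimes>\<^bsub>G\<^esub> h) s = \<psi> g (\<psi> h s)"
      using surj g by (force simp: simps act_mult)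
  next
    fix s assume "s \<in> carrier S"
    then show "\<psi> \<one>\<^bsub>G\<^esub> s = s" using surj by (force simp: simps act_one)
  qed (rule S G.group_axioms)+
  moreover have "f \<in> difference_hom G R \<phi> S \<psi>" using f(1) \<psi> by (simp add: difference_hom_def)
  ultimately show thesis by (rule that)
qed

text \<open>Renaming elements along \<open>j\<close> moves a difference field into a prescribed
  type. This serves to copy \<open>K\<close> into the host type and to realise fraction fields
  there.\<close>

lemma (in difference_field) image_difference_field:
  assumes inj: "inj_on j (carrier R)"
  obtains S :: "'u ring" and \<psi> where "difference_field G S \<psi>" "carrier S = j ` carrier R"
    "j \<in> difference_hom G R \<phi> S \<psi>"
proof -
  have fld: "field (image_ring j R)" using inj by (rule inj_imp_image_ring_is_field)
  then interpret S: field "image_ring j R" .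
  have hom: "j \<in> ring_hom R (image_ring j R)"
    using inj_imp_image_ring_iso[OF inj] by (simp add: ring_iso_def)
  obtain \<psi> where "difference_ring G (image_ring j R) \<psi>" "j \<in> difference_hom G R \<phi> (image_ring j R) \<psi>"
  proof (rule action_descends[OF S.is_cring hom])
    show "j ` carrier R = carrier (image_ring j R)" by (simp add: image_ring_carrier)
  qed (use inj in \<open>auto dest: inj_onD\<close>)
  then show thesis
    using that[of "image_ring j R" \<psi>] fld by (simp add: difference_field_def image_ring_carrier)
qed

text \<open>Stability of \<open>P\<close> under the group makes the action respect congruence modulo
  \<open>P\<close>: the difference of two representatives of a coset stays in \<open>P\<close> when
  translated.\<close>

lemma (in difference_ring) quotient_difference_domain:
  assumes P: "primeideal P R" "difference_ideal G R \<phi> P"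
  obtains \<psi> where "difference_domain G (R Quot P) \<psi>" "(+>) P \<in> difference_hom G R \<phi> (R Quot P) \<psi>"
proof -
  interpret P: primeideal P R by fact
  interpret Q: domain "R Quot P" by (rule P.quotient_is_domain)
  have eq: "P +> x = P +> y \<longleftrightarrow> x \<ominus> y \<in> P" if "x \<in> carrier R" "y \<in> carrier R" for x y
    using quotient_eq_iff_same_a_r_cos[OF P.is_ideal that] by simp
  obtain \<psi> where "difference_ring G (R Quot P) \<psi>" "(+>) P \<in> difference_hom G R \<phi> (R Quot P) \<psi>"
  proof (rule action_descends[OF Q.is_cring P.rcos_ring_hom])
    show "(+>) P ` carrier R = carrier (R Quot P)"
      by (auto simp: FactRing_def A_RCOSETS_def')
    fix g x y assume gxy: "g \<in> carrier G" "x \<in> carrier R" "y \<in> carrier R" "P +> x = P +> y"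
    then have "\<phi> g (x \<ominus> y) \<in> P"
      using P(2) eq unfolding difference_ideal_def by blast
    moreover have "\<phi> g (x \<ominus> y) = \<phi> g x \<ominus> \<phi> g y"
    proof -
      interpret h: ring_hom_ring R R "\<phi> g"
        by (rule ring_hom_ringI2) (use gxy act_hom ring_axioms in auto)
      show ?thesis using gxy by (simp add: a_minus_def)
    qed
    ultimately show "P +> \<phi> g x = P +> \<phi> g y" using gxy eq by (simp add: act_closed)
  qed
  then show thesis using that Q.domain_axioms by (simp add: difference_domain_def)
qed

section \<open>Fraction fields\<close>

context domain
begin

text \<open>The fraction a/b as the equivalence class of the pair \<open>(a, b)\<close> under cross
  multiplication.\<close>

definition frac :: "'a \<Rightarrow> 'a \<Rightarrow> ('a \<times> 'a) set"
  where "frac a b = {(x, y). x \<in> carrier R \<and> y \<in> carrier R - {\<zero>} \<and> a \<otimes> y = x \<otimes> b}"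

definition frac_rep :: "('a \<times> 'a) set \<Rightarrow> 'a \<times> 'a"
  where "frac_rep z = (SOME (a, b). a \<in> carrier R \<and> b \<in> carrier R - {\<zero>} \<and> z = frac a b)"

definition frac_field :: "('a \<times> 'a) set ring"
  where "frac_field =
    \<lparr>carrier = {frac a b | a b. a \<in> carrier R \<and> b \<in> carrier R - {\<zero>}},
     monoid.mult = (\<lambda>w z. case (frac_rep w, frac_rep z) of ((a, b), (c, d)) \<Rightarrow> frac (a \<otimes> c) (b \<otimes> d)),
     one = frac \<one> \<one>,
     zero = frac \<zero> \<one>,
     add = (\<lambda>w z. case (frac_rep w, frac_rep z) of
       ((a, b), (c, d)) \<Rightarrow> frac (a \<otimes> d \<oplus> c \<otimes> b) (b \<otimes> d))\<rparr>"

text \<open>Cross multiplication is transitive because nonzero denominators cancel in a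
  domain.\<close>

lemma frac_eq_iff:
  assumes "a \<in> carrier R" "b \<in> carrier R - {\<zero>}" "c \<in> carrier R" "d \<in> carrier R - {\<zero>}"
  shows "frac a b = frac c d \<longleftrightarrow> a \<otimes> d = c \<otimes> b"
proof
  assume "frac a b = frac c d"
  moreover have "(c, d) \<in> frac c d" using assms by (simp add: frac_def)
  ultimately have "(c, d) \<in> frac a b" by simp
  then show "a \<otimes> d = c \<otimes> b" by (simp add: frac_def)
next
  assume eq: "a \<otimes> d = c \<otimes> b"
  have "a \<otimes> y = x \<otimes> b \<longleftrightarrow> c \<otimes> y = x \<otimes> d" if "x \<in> carrier R" "y \<in> carrier R" for x y
  proof -
    have "a \<otimes> y = x \<otimes> b \<longleftrightarrow> (a \<otimes> y) \<otimes> d = (x \<otimes> b) \<otimes> d"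
      using assms that by (auto simp: m_rcancel)
    also have "(a \<otimes> y) \<otimes> d = (a \<otimes> d) \<otimes> y" using assms that by (simp add: m_ac)
    also have "\<dots> = (c \<otimes> y) \<otimes> b" using assms that by (simp add: eq m_ac)
    also have "(x \<otimes> b) \<otimes> d = (x \<otimes> d) \<otimes> b" using assms that by (simp add: m_ac)
    also have "(c \<otimes> y) \<otimes> b = (x \<otimes> d) \<otimes> b \<longleftrightarrow> c \<otimes> y = x \<otimes> d"
      using assms that by (auto simp: m_rcancel)
    finally show ?thesis .
  qed
  then show "frac a b = frac c d" by (auto simp: frac_def)
qed

lemma frac_rep:
  assumes "a \<in> carrier R" "b \<in> carrier R - {\<zero>}"
  obtains a' b' where "frac_rep (frac a b) = (a', b')" "a' \<in> carrier R" "b' \<in> carrier R - {\<zero>}"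
    "a \<otimes> b' = a' \<otimes> b"
proof -
  have "case frac_rep (frac a b) of (a', b') \<Rightarrow>
      a' \<in> carrier R \<and> b' \<in> carrier R - {\<zero>} \<and> frac a b = frac a' b'"
    unfolding frac_rep_def by (rule someI[where x = "(a, b)"]) (use assms in simp)
  then show thesis using that frac_eq_iff[OF assms] by (auto split: prod.splits)
qed

text \<open>The product in \<open>frac_field\<close> is computed from representatives picked by
  \<open>frac_rep\<close>; cross multiplication shows that every other choice gives the same
  class.\<close>

lemma frac_mult:
  assumes ab: "a \<in> carrier R" "b \<in> carrier R - {\<zero>}" and cd: "c \<in> carrier R" "d \<in> carrier R - {\<zero>}"
  shows "frac a b \<otimes>\<^bsub>frac_field\<^esub> frac c d = frac (a \<otimes> c) (b \<otimes> d)"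
proof -
  obtain a' b' where 1: "frac_rep (frac a b) = (a', b')" "a' \<in> carrier R" "b' \<in> carrier R - {\<zero>}"
    "a \<otimes> b' = a' \<otimes> b" using frac_rep[OF ab] .
  obtain c' d' where 2: "frac_rep (frac c d) = (c', d')" "c' \<in> carrier R" "d' \<in> carrier R - {\<zero>}"
    "c \<otimes> d' = c' \<otimes> d" using frac_rep[OF cd] .
  have "(a \<otimes> c) \<otimes> (b' \<otimes> d') = (a \<otimes> b') \<otimes> (c \<otimes> d')" using ab cd 1(2,3) 2(2,3) by (simp add: m_ac)
  also have "\<dots> = (a' \<otimes> c') \<otimes> (b \<otimes> d)" using ab cd 1 2 by (simp add: m_ac)
  finally have "frac (a \<otimes> c) (b \<otimes> d) = frac (a' \<otimes> c') (b' \<otimes> d')"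
    by (subst frac_eq_iff) (use ab cd 1(2,3) 2(2,3) in \<open>auto simp: integral_iff\<close>)
  then show ?thesis by (simp add: frac_field_def 1(1) 2(1))
qed

lemma frac_add:
  assumes ab: "a \<in> carrier R" "b \<in> carrier R - {\<zero>}" and cd: "c \<in> carrier R" "d \<in> carrier R - {\<zero>}"
  shows "frac a b \<oplus>\<^bsub>frac_field\<^esub> frac c d = frac (a \<otimes> d \<oplus> c \<otimes> b) (b \<otimes> d)"
proof -
  obtain a' b' where 1: "frac_rep (frac a b) = (a', b')" "a' \<in> carrier R" "b' \<in> carrier R - {\<zero>}"
    "a \<otimes> b' = a' \<otimes> b" using frac_rep[OF ab] .
  obtain c' d' where 2: "frac_rep (frac c d) = (c', d')" "c' \<in> carrier R" "d' \<in> carrier R - {\<zero>}"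
    "c \<otimes> d' = c' \<otimes> d" using frac_rep[OF cd] .
  have "(a \<otimes> d \<oplus> c \<otimes> b) \<otimes> (b' \<otimes> d') = (a \<otimes> b') \<otimes> (d \<otimes> d') \<oplus> (c \<otimes> d') \<otimes> (b \<otimes> b')"
    using ab cd 1(2,3) 2(2,3) by (simp add: l_distr r_distr m_ac)
  also have "\<dots> = (a' \<otimes> d' \<oplus> c' \<otimes> b') \<otimes> (b \<otimes> d)"
    unfolding 1(4) 2(4) using ab cd 1(2,3) 2(2,3) by (simp add: l_distr r_distr m_ac)
  finally have "frac (a \<otimes> d \<oplus> c \<otimes> b) (b \<otimes> d) = frac (a' \<otimes> d' \<oplus> c' \<otimes> b') (b' \<otimes> d')"
    by (subst frac_eq_iff) (use ab cd 1(2,3) 2(2,3) in \<open>auto simp: integral_iff\<close>)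
  then show ?thesis by (simp add: frac_field_def 1(1) 2(1))
qed

lemma frac_field_carrierE:
  assumes "z \<in> carrier frac_field"
  obtains a b where "a \<in> carrier R" "b \<in> carrier R - {\<zero>}" "z = frac a b"
  using assms by (auto simp: frac_field_def)

lemma frac_closed: "a \<in> carrier R \<Longrightarrow> b \<in> carrier R - {\<zero>} \<Longrightarrow> frac a b \<in> carrier frac_field"
  by (auto simp: frac_field_def)

lemma frac_zero: "\<zero>\<^bsub>frac_field\<^esub> = frac \<zero> \<one>" and frac_one: "\<one>\<^bsub>frac_field\<^esub> = frac \<one> \<one>"
  by (simp_all add: frac_field_def)

lemma cring_frac_field: "cring frac_field"
proof (rule cringI)
  show "abelian_group frac_field"
  proof (rule abelian_groupI)
    fix w z u assume "w \<in> carrier frac_field" "z \<in> carrier frac_field" "u \<in> carrier frac_field"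
    then obtain a b c d e f where 1: "a \<in> carrier R" "b \<in> carrier R - {\<zero>}" "w = frac a b"
      and 2: "c \<in> carrier R" "d \<in> carrier R - {\<zero>}" "z = frac c d"
      and 3: "e \<in> carrier R" "f \<in> carrier R - {\<zero>}" "u = frac e f"
      by (metis frac_field_carrierE)
    show "w \<oplus>\<^bsub>frac_field\<^esub> z \<in> carrier frac_field"
      using 1 2 by (simp add: frac_add frac_closed integral_iff)
    show "w \<oplus>\<^bsub>frac_field\<^esub> z \<oplus>\<^bsub>frac_field\<^esub> u = w \<oplus>\<^bsub>frac_field\<^esub> (z \<oplus>\<^bsub>frac_field\<^esub> u)"
      using 1 2 3 by (simp add: frac_add integral_iff l_distr r_distr m_ac a_ac)
    show "w \<oplus>\<^bsub>frac_field\<^esub> z = z \<oplus>\<^bsub>frac_field\<^esub> w"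
      using 1 2 by (simp add: frac_add m_ac a_ac)
    show "\<zero>\<^bsub>frac_field\<^esub> \<oplus>\<^bsub>frac_field\<^esub> w = w"
      using 1 by (simp add: frac_add frac_zero)
    have "frac (\<ominus> a) b \<oplus>\<^bsub>frac_field\<^esub> w = \<zero>\<^bsub>frac_field\<^esub>"
      using 1 by (simp add: frac_add frac_zero frac_eq_iff integral_iff l_minus l_neg)
    then show "\<exists>v\<in>carrier frac_field. v \<oplus>\<^bsub>frac_field\<^esub> w = \<zero>\<^bsub>frac_field\<^esub>"
      using 1 by (blast intro: frac_closed a_inv_closed)
  qed (simp add: frac_zero frac_closed)
  show "Group.comm_monoid frac_field"
  proof (rule comm_monoidI)
    fix w z u assume "w \<in> carrier frac_field" "z \<in> carrier frac_field" "u \<in> carrier frac_field"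
    then obtain a b c d e f where 1: "a \<in> carrier R" "b \<in> carrier R - {\<zero>}" "w = frac a b"
      and 2: "c \<in> carrier R" "d \<in> carrier R - {\<zero>}" "z = frac c d"
      and 3: "e \<in> carrier R" "f \<in> carrier R - {\<zero>}" "u = frac e f"
      by (metis frac_field_carrierE)
    show "w \<otimes>\<^bsub>frac_field\<^esub> z \<otimes>\<^bsub>frac_field\<^esub> u = w \<otimes>\<^bsub>frac_field\<^esub> (z \<otimes>\<^bsub>frac_field\<^esub> u)"
      using 1 2 3 by (simp add: frac_mult integral_iff m_ac)
  next
    fix w z assume "w \<in> carrier frac_field" "z \<in> carrier frac_field"
    then obtain a b c d where 1: "a \<in> carrier R" "b \<in> carrier R - {\<zero>}" "w = frac a b"
      and 2: "c \<in> carrier R" "d \<in> carrier R - {\<zero>}" "z = frac c d"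
      by (metis frac_field_carrierE)
    show "w \<otimes>\<^bsub>frac_field\<^esub> z \<in> carrier frac_field"
      using 1 2 by (simp add: frac_mult frac_closed integral_iff)
    show "w \<otimes>\<^bsub>frac_field\<^esub> z = z \<otimes>\<^bsub>frac_field\<^esub> w"
      using 1 2 by (simp add: frac_mult m_ac)
    show "\<one>\<^bsub>frac_field\<^esub> \<otimes>\<^bsub>frac_field\<^esub> w = w"
      using 1 by (simp add: frac_mult frac_one)
  qed (simp add: frac_one frac_closed)
  fix w z u assume "w \<in> carrier frac_field" "z \<in> carrier frac_field" "u \<in> carrier frac_field"
  then obtain a b c d e f where 1: "a \<in> carrier R" "b \<in> carrier R - {\<zero>}" "w = frac a b"
    and 2: "c \<in> carrier R" "d \<in> carrier R - {\<zero>}" "z = frac c d"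
    and 3: "e \<in> carrier R" "f \<in> carrier R - {\<zero>}" "u = frac e f"
    by (metis frac_field_carrierE)
  show "(w \<oplus>\<^bsub>frac_field\<^esub> z) \<otimes>\<^bsub>frac_field\<^esub> u =
      w \<otimes>\<^bsub>frac_field\<^esub> u \<oplus>\<^bsub>frac_field\<^esub> z \<otimes>\<^bsub>frac_field\<^esub> u"
    using 1 2 3 by (simp add: frac_add frac_mult integral_iff frac_eq_iff l_distr r_distr m_ac)
qed

lemma field_frac_field: "field frac_field"
proof (rule cring.cring_fieldI2[OF cring_frac_field])
  show "\<zero>\<^bsub>frac_field\<^esub> \<noteq> \<one>\<^bsub>frac_field\<^esub>" by (simp add: frac_zero frac_one frac_eq_iff)
  fix z assume z: "z \<in> carrier frac_field" "z \<noteq> \<zero>\<^bsub>frac_field\<^esub>"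
  then obtain a b where ab: "a \<in> carrier R" "b \<in> carrier R - {\<zero>}" "z = frac a b"
    by (metis frac_field_carrierE)
  then have "a \<noteq> \<zero>" using z by (auto simp: frac_zero frac_eq_iff)
  then have "z \<otimes>\<^bsub>frac_field\<^esub> frac b a = \<one>\<^bsub>frac_field\<^esub>"
    using ab by (simp add: frac_mult frac_one frac_eq_iff integral_iff m_ac)
  then show "\<exists>w\<in>carrier frac_field. z \<otimes>\<^bsub>frac_field\<^esub> w = \<one>\<^bsub>frac_field\<^esub>"
    using ab \<open>a \<noteq> \<zero>\<close> by (blast intro: frac_closed)
qed

end

text \<open>Automorphisms keep denominators nonzero, so acting on numerator and denominator is well
  defined on fractions. The last clause lets a pair of ring elements label each element of the
  field.\<close>

lemma (in difference_domain) fraction_difference_field: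
  obtains F :: "('c \<times> 'c) set ring" and \<psi> h where "difference_field G F \<psi>"
    "h \<in> difference_hom G R \<phi> F \<psi>"
    "\<forall>z\<in>carrier F. \<exists>a\<in>carrier R. \<exists>b\<in>carrier R. z = h a \<otimes>\<^bsub>F\<^esub> inv\<^bsub>F\<^esub> h b"
proof -
  interpret G: Group.group G by (rule group_G)
  interpret F: field frac_field by (rule field_frac_field)
  define \<psi> where "\<psi> g = (\<lambda>z\<in>carrier frac_field.
    case frac_rep z of (a, b) \<Rightarrow> frac (\<phi> g a) (\<phi> g b))" for g
  have act_nz: "\<phi> g b \<in> carrier R - {\<zero>}" if "g \<in> carrier G" "b \<in> carrier R - {\<zero>}" for g b
  proof -
    have "inj_on (\<phi> g) (carrier R)" using act_iso[OF that(1)] by (simp add: ring_iso_def bij_betw_def)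
    then show ?thesis
      using that act_zero[OF that(1)] by (auto simp: act_closed dest: inj_onD[of _ _ b \<zero>])
  qed
  have \<psi>: "\<psi> g (frac a b) = frac (\<phi> g a) (\<phi> g b)"
    if g: "g \<in> carrier G" and ab: "a \<in> carrier R" "b \<in> carrier R - {\<zero>}" for g a b
  proof -
    obtain a' b' where 1: "frac_rep (frac a b) = (a', b')" "a' \<in> carrier R" "b' \<in> carrier R - {\<zero>}"
      "a \<otimes> b' = a' \<otimes> b" using frac_rep[OF ab] .
    have "\<phi> g a \<otimes> \<phi> g b' = \<phi> g a' \<otimes> \<phi> g b"
      using ab 1 ring_hom_mult[OF act_hom[OF g]] by (metis DiffE)
    then have "frac (\<phi> g a) (\<phi> g b) = frac (\<phi> g a') (\<phi> g b')"
      using g ab 1(2,3) act_nz by (simp add: frac_eq_iff act_closed)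
    then show ?thesis using ab by (simp add: \<psi>_def 1(1) frac_closed)
  qed
  have act_nz': "\<phi> g b \<noteq> \<zero>" if "g \<in> carrier G" "b \<in> carrier R" "b \<noteq> \<zero>" for g b
    using act_nz that by blast
  note simps = \<psi> act_closed frac_closed act_nz' integral_iff
  have "difference_ring G frac_field \<psi>"
  proof (rule difference_ringI)
    fix g assume g: "g \<in> carrier G"
    show "\<psi> g \<in> ring_hom frac_field frac_field"
    proof (rule ring_hom_memI)
      fix w z assume "w \<in> carrier frac_field" "z \<in> carrier frac_field"
      then obtain a b c d where 1: "a \<in> carrier R" "b \<in> carrier R - {\<zero>}" "w = frac a b"
        and 2: "c \<in> carrier R" "d \<in> carrier R - {\<zero>}" "z = frac c d"
        by (metis frac_field_carrierE)
      show "\<psi> g w \<in> carrier frac_field" using 1 g by (simp add: simps)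
      show "\<psi> g (w \<otimes>\<^bsub>frac_field\<^esub> z) = \<psi> g w \<otimes>\<^bsub>frac_field\<^esub> \<psi> g z"
        using 1 2 g by (simp add: simps frac_mult ring_hom_mult[OF act_hom])
      show "\<psi> g (w \<oplus>\<^bsub>frac_field\<^esub> z) = \<psi> g w \<oplus>\<^bsub>frac_field\<^esub> \<psi> g z"
        using 1 2 g by (simp add: simps frac_add ring_hom_mult[OF act_hom] ring_hom_add[OF act_hom])
    next
      show "\<psi> g \<one>\<^bsub>frac_field\<^esub> = \<one>\<^bsub>frac_field\<^esub>"
        using g by (simp add: frac_one \<psi> ring_hom_one[OF act_hom])
    qed
    show "\<psi> g \<in> extensional (carrier frac_field)" by (simp add: \<psi>_def)
    fix h z assume "h \<in> carrier G" "z \<in> carrier frac_field"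
    then show "\<psi> (g \<otimes>\<^bsub>G\<^esub> h) z = \<psi> g (\<psi> h z)"
      using g by (elim frac_field_carrierE) (simp add: simps act_mult)
  next
    fix z assume "z \<in> carrier frac_field"
    then show "\<psi> \<one>\<^bsub>G\<^esub> z = z" by (elim frac_field_carrierE) (simp add: simps act_one)
  qed (rule F.is_cring G.group_axioms)+
  moreover define h where "h a = frac a \<one>" for a
  have "h \<in> difference_hom G R \<phi> frac_field \<psi>"
  proof -
    have "h \<in> ring_hom R frac_field"
      by (rule ring_hom_memI) (simp_all add: h_def frac_closed frac_mult frac_add frac_one)
    then show ?thesis by (auto simp: difference_hom_def h_def \<psi> ring_hom_one[OF act_hom])
  qed
  moreover have "\<exists>a\<in>carrier R. \<exists>b\<in>carrier R. z = h a \<otimes>\<^bsub>frac_field\<^esub> inv\<^bsub>frac_field\<^esub> h b"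
    if z: "z \<in> carrier frac_field" for z
  proof -
    obtain a b where ab: "a \<in> carrier R" "b \<in> carrier R - {\<zero>}" "z = frac a b"
      using z by (metis frac_field_carrierE)
    have "inv\<^bsub>frac_field\<^esub> h b = frac \<one> b"
      by (rule F.comm_inv_char)
        (use ab in \<open>simp_all add: h_def frac_closed frac_mult frac_one frac_eq_iff\<close>)
    then have "z = h a \<otimes>\<^bsub>frac_field\<^esub> inv\<^bsub>frac_field\<^esub> h b"
      using ab by (simp add: h_def frac_mult)
    then show ?thesis using ab by blast
  qed
  ultimately show thesis
    using that[of frac_field \<psi> h] F.field_axioms by (simp add: difference_field_def)
qed

section \<open>Ideals of polynomial rings over a field\<close>

text \<open>Applied to the support of a nonzero polynomial, this provides its leading
  monomial.\<close>

lemma total_trans_finite_max: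
  assumes "total_on A r" "trans r" "finite S" "S \<noteq> {}" "S \<subseteq> A"
  shows "\<exists>m\<in>S. \<forall>k\<in>S. k = m \<or> (k, m) \<in> r"
  using assms(3-5)
proof (induction rule: finite_ne_induct)
  case (insert x S)
  then obtain m where m: "m \<in> S" "\<forall>k\<in>S. k = m \<or> (k, m) \<in> r" by auto
  show ?case
  proof (cases "(m, x) \<in> r")
    case True
    then show ?thesis using m assms(2) by (auto dest: transD)
  next
    case False
    then have "x = m \<or> (x, m) \<in> r" using assms(1) m(1) insert by (auto simp: total_on_def)
    then show ?thesis using m by auto
  qed
qed simp

text \<open>Well-order the monomials; the ideal is already spanned, as a vector space, by one of its
  elements for every leading monomial.\<close>

lemma (in field) mpoly_ideal_generated_by_monomial_family:
  fixes V :: "'v set"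
  assumes I: "ideal I (mpoly_ring R V)"
  obtains E :: "'v multiset \<Rightarrow> 'v multiset \<Rightarrow> 'a"
  where "range E \<subseteq> I" "\<forall>J. ideal J (mpoly_ring R V) \<and> range E \<subseteq> J \<longrightarrow> I \<subseteq> J"
proof -
  let ?P = "mpoly_ring R V"
  interpret P: cring ?P by (rule cring_mpoly_ring)
  interpret I: ideal I ?P by fact
  \<comment> \<open>Only scalar multiples of members of \<open>I\<close> are added below, so an
    arbitrary well-order of the monomials serves.\<close>
  obtain r :: "'v multiset rel" where "well_order_on UNIV r" using well_order_on by blast
  then have wf: "wf (r - Id)" and tot: "total r" and tr: "trans r" and "refl r"
    by (auto simp: well_order_on_def linear_order_on_def partial_order_on_def preorder_on_def)
  have coeff: "p m \<in> carrier R" if "p \<in> carrier ?P" for p m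
    using that by (simp add: mpoly_ring_def indexed_pset_coeff)
  define lead where "lead p m \<longleftrightarrow> p m \<noteq> \<zero> \<and> (\<forall>k. p k \<noteq> \<zero> \<longrightarrow> (k, m) \<in> r)" for p m
  \<comment> \<open>Monomials that lead no member of \<open>I\<close> get the zero polynomial, which
    keeps the whole family inside \<open>I\<close>.\<close>
  define E where "E m = (if \<exists>p\<in>I. lead p m then SOME p. p \<in> I \<and> lead p m else \<zero>\<^bsub>?P\<^esub>)" for m
  have E: "E m \<in> I" "lead (E m) m" if "p \<in> I" "lead p m" for p m
    using that someI[of "\<lambda>p. p \<in> I \<and> lead p m" p] by (auto simp: E_def)
  have EI: "E m \<in> I" for m
  proof (cases "\<exists>p\<in>I. lead p m")
    case False
    then show ?thesis by (simp add: E_def)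
  qed (use E in blast)
  have "I \<subseteq> J" if J: "ideal J ?P" and EJ: "range E \<subseteq> J" for J
  proof
    interpret J: ideal J ?P by fact
    \<comment> \<open>The zero polynomial is in \<open>J\<close>; any other member of
      \<open>I\<close> has a largest monomial \<open>k\<close>, from which the induction below
      starts.\<close>
    have step: "p \<in> J" if "p \<in> I" and "\<And>k. p k \<noteq> \<zero> \<Longrightarrow> \<forall>l. p l \<noteq> \<zero> \<longrightarrow> (l, k) \<in> r \<Longrightarrow> p \<in> J" for p
    proof (cases "\<exists>k. p k \<noteq> \<zero>")
      case False
      then have "p = \<zero>\<^bsub>?P\<^esub>" by (auto simp: mpoly_ring_def indexed_const_def)
      then show ?thesis by simp
    next
      case True
      have "finite {k. p k \<noteq> \<zero>}"
        using I.Icarr[OF \<open>p \<in> I\<close>] indexed_pset_support(1) by (simp add: mpoly_ring_def)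
      with True obtain k where "p k \<noteq> \<zero>" "\<forall>l. p l \<noteq> \<zero> \<longrightarrow> l = k \<or> (l, k) \<in> r"
        using total_trans_finite_max[OF tot tr, of "{k. p k \<noteq> \<zero>}"] by auto
      then show ?thesis using that(2) \<open>refl r\<close> by (metis UNIV_I refl_onD)
    qed
    \<comment> \<open>Induction on a bound \<open>m\<close> for the support. When the coefficient at
      \<open>m\<close> vanishes, the leading monomial, if any, lies strictly below
      \<open>m\<close>.\<close>
    have main: "\<forall>p\<in>I. (\<forall>k. p k \<noteq> \<zero> \<longrightarrow> (k, m) \<in> r) \<longrightarrow> p \<in> J" for m
    proof (induction m rule: wf_induct_rule[OF wf])
      case (1 m)
      have below: "p \<in> J" if p: "p \<in> I" "\<forall>k. p k \<noteq> \<zero> \<longrightarrow> (k, m) \<in> r" "p m = \<zero>" for p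
      proof (rule step[OF p(1)])
        fix k assume k: "p k \<noteq> \<zero>" "\<forall>l. p l \<noteq> \<zero> \<longrightarrow> (l, k) \<in> r"
        then have "(k, m) \<in> r - Id" using p by auto
        then show "p \<in> J" using 1 p(1) k(2) by blast
      qed
      show ?case
      proof (intro ballI impI)
        fix p assume p: "p \<in> I" "\<forall>k. p k \<noteq> \<zero> \<longrightarrow> (k, m) \<in> r"
        show "p \<in> J"
        proof (cases "p m = \<zero>")
          case True
          then show ?thesis using below p by blast
        next
          case False
          then have "lead p m" using p by (simp add: lead_def)
          with p(1) have e: "E m \<in> I" "lead (E m) m" by (rule E)+
          note carr = I.Icarr[OF p(1)] I.Icarr[OF e(1)]
          \<comment> \<open>With this scalar, \<open>c\<close> times \<open>E m\<close> cancels the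
            coefficient of \<open>p\<close> at \<open>m\<close>. Both supports are bounded by
            \<open>m\<close>, so the support of the sum lies strictly below
            \<open>m\<close>.\<close>
          define c where "c = \<ominus> (p m \<otimes> inv (E m m))"
          have em: "E m m \<in> Units R" "p m \<in> carrier R"
            using e(2) coeff carr by (auto simp: lead_def field_Units)
          then have c: "c \<in> carrier R" by (simp add: c_def)
          define s where "s = E m \<otimes>\<^bsub>?P\<^esub> indexed_const c"
          have const: "indexed_const c \<in> carrier ?P"
            using c by (simp add: mpoly_ring_def indexed_pset.indexed_const)
          have s: "s = (\<lambda>k. E m k \<otimes> c)"
            using carr(2) c unfolding s_def
            by (simp add: mpoly_ring_def mpoly_mult_const pset_carrier_coeff[where V = V])
          have sI: "s \<in> I" and sJ: "s \<in> J"
            using const e(1) EJ unfolding s_def by (auto intro: I.I_r_closed J.I_r_closed)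
          define q where "q = p \<oplus>\<^bsub>?P\<^esub> s"
          have q: "q k = p k \<oplus> E m k \<otimes> c" for k
            by (simp add: q_def s) (simp add: mpoly_ring_def indexed_padd_def)
          have "q m = p m \<oplus> E m m \<otimes> c" by (rule q)
          also have "E m m \<otimes> c = \<ominus> (p m \<otimes> (E m m \<otimes> inv (E m m)))"
            using em unfolding c_def by (simp add: r_minus m_ac Units_closed)
          also have "p m \<oplus> \<dots> = \<zero>" using em by (simp add: r_neg)
          finally have "q m = \<zero>" .
          moreover have "(k, m) \<in> r" if "q k \<noteq> \<zero>" for k
          proof (rule ccontr)
            assume "(k, m) \<notin> r"
            then have "p k = \<zero>" "E m k = \<zero>" using p(2) e(2) by (auto simp: lead_def)
            then show False using that c by (simp add: q)
          qed
          moreover have "q \<in> I" unfolding q_def using p(1) sI by (rule I.a_closed)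
          ultimately have "q \<in> J" using below by blast
          moreover have "p = q \<ominus>\<^bsub>?P\<^esub> s"
            unfolding q_def a_minus_def using carr I.Icarr[OF sI]
            by (simp add: P.a_assoc P.r_neg)
          ultimately show ?thesis using sJ by (simp add: J.a_closed J.a_inv_closed a_minus_def)
        qed
      qed
    qed
    fix p assume "p \<in> I"
    then show "p \<in> J" using step main by blast
  qed
  then show thesis using that[of E] EI by blast
qed

section \<open>Evaluation of difference polynomials\<close>

text \<open>A difference homomorphism out of the polynomial ring is determined by the constants and
  the variables indexed by the unit of the group, since compatibility with the action fixes it on
  the other variables. The images of the former variables thus form a point at which evaluation is
  \<open>h\<close>.\<close>

lemma dpoly_eval_eq_hom:
  fixes G :: "('g, 'w) monoid_scheme" and A :: "('a, 'm) ring_scheme"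
    and B :: "('b, 'n) ring_scheme" and Y :: "'y set"
  assumes A: "difference_ring G A \<phi>" and B: "difference_ring G B \<psi>"
    and h: "h \<in> difference_hom G (dpoly_ring G A Y) (dpoly_act G A \<phi> Y) B \<psi>"
    and \<iota>: "\<And>c. c \<in> carrier A \<Longrightarrow> \<iota> c = h (ring.indexed_const A c)"
    and b: "\<And>y. y \<in> Y \<Longrightarrow> b y = h (ring.indexed_var A (\<one>\<^bsub>G\<^esub>, y))"
    and p: "p \<in> carrier (dpoly_ring G A Y)"
  shows "dpoly_eval A B \<psi> \<iota> b p = h p"
proof -
  interpret A: difference_ring G A \<phi> by fact
  interpret B: difference_ring G B \<psi> by fact
  interpret G: Group.group G by (rule A.group_G)
  let ?P = "dpoly_ring G A Y"
  interpret P: difference_ring G ?P "dpoly_act G A \<phi> Y" by (rule A.difference_ring_dpoly_ring)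
  have hom: "h \<in> ring_hom ?P B" using h by (simp add: difference_hom_def)
  have const: "A.indexed_const c \<in> A.PY Y" if "c \<in> carrier A" for c
    using that by (rule A.indexed_pset.indexed_const)
  have var: "A.indexed_var (\<one>\<^bsub>G\<^esub>, y) \<in> A.PY Y" if "y \<in> Y" for y
    unfolding A.indexed_var_def using that by (intro A.indexed_pset.indexed_pmult const) auto
  have ops: "\<one>\<^bsub>?P\<^esub> = A.indexed_const \<one>\<^bsub>A\<^esub>" "p \<oplus>\<^bsub>?P\<^esub> q = A.indexed_padd p q"
    "p \<otimes>\<^bsub>?P\<^esub> q = mpoly_mult A p q" for p q
    by (simp_all add: dpoly_ring_def mpoly_ring_def)
  have h_padd: "h (A.indexed_padd p q) = h p \<oplus>\<^bsub>B\<^esub> h q"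
    and h_mult: "h (mpoly_mult A p q) = h p \<otimes>\<^bsub>B\<^esub> h q"
    if "p \<in> A.PY Y" "q \<in> A.PY Y" for p q
    using ring_hom_add[OF hom, of p q] ring_hom_mult[OF hom, of p q] that
    by (simp_all add: ops A.carrier_dpoly_ring)
  have h_closed: "h p \<in> carrier B" if "p \<in> A.PY Y" for p
    using ring_hom_closed[OF hom] that by (simp add: A.carrier_dpoly_ring)
  have act_var: "\<psi> g (b y) = h (A.indexed_var (g, y))" if "g \<in> carrier G" "y \<in> Y" for g y
  proof -
    have "dpoly_act G A \<phi> Y g (A.indexed_var (\<one>\<^bsub>G\<^esub>, y)) = A.indexed_var (g, y)"
      unfolding A.indexed_var_def using that
      by (simp add: A.dpoly_act_pmult const A.dpoly_act_const ring_hom_one[OF A.act_hom])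
    moreover have "h (dpoly_act G A \<phi> Y g (A.indexed_var (\<one>\<^bsub>G\<^esub>, y))) = \<psi> g (b y)"
      using h var that by (simp add: difference_hom_def A.carrier_dpoly_ring b)
    ultimately show ?thesis by simp
  qed
  interpret E: mpoly_eval_at A B \<iota> "carrier G \<times> Y" "\<lambda>(g, y). \<psi> g (b y)"
  proof unfold_locales
    show "\<iota> \<in> ring_hom A B"
    proof (rule ring_hom_memI)
      fix x y assume xy: "x \<in> carrier A" "y \<in> carrier A"
      have "(A.indexed_const (x \<otimes>\<^bsub>A\<^esub> y) :: ('g \<times> 'y) multiset \<Rightarrow> 'a) =
          mpoly_mult A (A.indexed_const x) (A.indexed_const y)"
        using xy by (subst A.mpoly_mult_const)
          (auto simp: A.indexed_const_def A.carrier_coeff_def)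
      then show "\<iota> (x \<otimes>\<^bsub>A\<^esub> y) =
          \<iota> x \<otimes>\<^bsub>B\<^esub> \<iota> y"
        using xy const h_mult by (simp add: \<iota>)
      have "(A.indexed_const (x \<oplus>\<^bsub>A\<^esub> y) :: ('g \<times> 'y) multiset \<Rightarrow> 'a) =
          A.indexed_padd (A.indexed_const x) (A.indexed_const y)"
        using xy by (auto simp: A.indexed_const_def A.indexed_padd_def)
      then show "\<iota> (x \<oplus>\<^bsub>A\<^esub> y) =
          \<iota> x \<oplus>\<^bsub>B\<^esub> \<iota> y"
        using xy const h_padd by (simp add: \<iota>)
    qed (use const h_closed ring_hom_one[OF hom] in \<open>auto simp: ops \<iota>\<close>)
    show "(\<lambda>(g, y). \<psi> g (b y)) v \<in> carrier B" if "v \<in> carrier G \<times> Y" for v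
      using that var h_closed by (auto simp: b intro: B.act_closed)
  qed
  have "E.ev p = h p"
    using p unfolding A.carrier_dpoly_ring
  proof (induction rule: A.indexed_pset.induct)
    case (indexed_const k)
    then show ?case by (simp add: E.ev_const \<iota>)
  next
    case (indexed_padd p q)
    then show ?case by (simp add: E.ev_padd h_padd)
  next
    case (indexed_pmult p i)
    then obtain g y where i: "i = (g, y)" "g \<in> carrier G" "y \<in> Y" by auto
    have v: "A.indexed_var i \<in> A.PY Y"
      unfolding A.indexed_var_def using indexed_pmult(2) by (intro A.indexed_pset.indexed_pmult const) auto
    note coeff = A.pset_carrier_coeff[where V = "carrier G \<times> Y"]
    \<comment> \<open>Multiplication by a variable is rewritten as a product in the polynomial ring,
      to which multiplicativity of \<open>h\<close> applies.\<close>
    have "mpoly_mult A p (A.indexed_var i) = A.indexed_pmult (mpoly_mult A p (A.indexed_const \<one>\<^bsub>A\<^esub>)) i"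
      unfolding A.indexed_var_def using indexed_pmult(1) const
      by (simp add: A.mpoly_mult_pmult coeff)
    also have "mpoly_mult A p (A.indexed_const \<one>\<^bsub>A\<^esub>) = p"
      using indexed_pmult(1) A.indexed_pset_coeff[OF indexed_pmult(1)]
      by (simp add: A.mpoly_mult_const coeff)
    finally have "h (A.indexed_pmult p i) = h p \<otimes>\<^bsub>B\<^esub> h (A.indexed_var i)"
      using h_mult[OF indexed_pmult(1) v] by simp
    then show ?case using indexed_pmult i by (simp add: E.ev_pmult act_var)
  qed
  then show ?thesis by (simp add: dpoly_eval_def)
qed

text \<open>That \<open>B\<close> extends \<open>A\<close> is expressed by the identity being a
  difference homomorphism. The zero and the sums of \<open>A\<close> are then those of
  \<open>B\<close>, and the inductive generation of polynomials carries over.\<close>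

lemma dpoly_ring_extension:
  fixes G :: "('g, 'w) monoid_scheme" and Y :: "'y set"
  assumes A: "difference_ring G A \<phi>" and B: "difference_ring G B \<psi>"
    and ext: "(\<lambda>x. x) \<in> difference_hom G A \<phi> B \<psi>"
  shows "carrier (dpoly_ring G A Y) \<subseteq> carrier (dpoly_ring G B Y)"
proof
  interpret A: difference_ring G A \<phi> by fact
  interpret B: difference_ring G B \<psi> by fact
  have hom: "(\<lambda>x. x) \<in> ring_hom A B" using ext by (simp add: difference_hom_def)
  have zero: "\<zero>\<^bsub>A\<^esub> = \<zero>\<^bsub>B\<^esub>" using ring_hom_zero[OF hom A.ring_axioms B.ring_axioms] .
  fix p assume "p \<in> carrier (dpoly_ring G A Y)"
  then show "p \<in> carrier (dpoly_ring G B Y)"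
    unfolding A.carrier_dpoly_ring B.carrier_dpoly_ring
  proof (induction rule: A.indexed_pset.induct)
    case (indexed_const k)
    have "(A.indexed_const k :: ('g \<times> 'y) multiset \<Rightarrow> _) = B.indexed_const k"
      unfolding A.indexed_const_def B.indexed_const_def zero ..
    then show ?case
      using B.indexed_pset.indexed_const[OF ring_hom_closed[OF hom indexed_const]] by (simp only:)
  next
    case (indexed_padd p q)
    have "A.indexed_padd p q = B.indexed_padd p q"
      using indexed_padd(1,2)[THEN A.indexed_pset_coeff] ring_hom_add[OF hom]
      by (simp add: A.indexed_padd_def B.indexed_padd_def)
    then show ?case using indexed_padd by (simp add: B.indexed_pset.indexed_padd)
  next
    case (indexed_pmult p i)
    have "A.indexed_pmult p i = B.indexed_pmult p i"
      unfolding A.indexed_pmult_def B.indexed_pmult_def zero ..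
    then show ?case using indexed_pmult by (simp add: B.indexed_pset.indexed_pmult)
  qed
qed

text \<open>The coefficient ring enters evaluation only through its zero, which delimits the
  support.\<close>

lemma dpoly_eval_same_zero:
  "\<zero>\<^bsub>A\<^esub> = \<zero>\<^bsub>A'\<^esub> \<Longrightarrow> dpoly_eval A B \<psi> \<iota> b p = dpoly_eval A' B \<psi> \<iota> b p"
  by (simp add: dpoly_eval_def mpoly_eval_def)

text \<open>The inclusion commutes with evaluation. This carries zeros up to a larger ring, and back
  down when their coordinates lie in the smaller one.\<close>

lemma common_zero_extension:
  assumes A: "difference_ring G A \<phi>" and B: "difference_ring G B \<psi>"
    and ext: "(\<lambda>x. x) \<in> difference_hom G A \<phi> B \<psi>"
    and E: "E \<subseteq> carrier (dpoly_ring G A Y)" and b: "b \<in> Y \<rightarrow> carrier A"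
  shows "common_zero B B \<psi> (\<lambda>x. x) Y E b \<longleftrightarrow> common_zero A A \<phi> (\<lambda>x. x) Y E b"
proof -
  interpret A: difference_ring G A \<phi> by fact
  interpret B: difference_ring G B \<psi> by fact
  have hom: "(\<lambda>x. x) \<in> ring_hom A B" using ext by (simp add: difference_hom_def)
  have zero: "\<zero>\<^bsub>A\<^esub> = \<zero>\<^bsub>B\<^esub>" using ring_hom_zero[OF hom A.ring_axioms B.ring_axioms] .
  have id: "(\<lambda>x. x) \<in> difference_hom G A \<phi> A \<phi>"
    by (auto simp: difference_hom_def intro: ring_hom_memI)
  have "dpoly_eval B B \<psi> (\<lambda>x. x) b p = dpoly_eval A A \<phi> (\<lambda>x. x) b p" if "p \<in> E" for p
  proof -
    have p: "p \<in> carrier (dpoly_ring G A Y)" using that E by blast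
    have "dpoly_eval A B \<psi> ((\<lambda>x. x) \<circ> (\<lambda>x. x)) ((\<lambda>x. x) \<circ> b) p = dpoly_eval A A \<phi> (\<lambda>x. x) b p"
    proof (rule dpoly_eval_hom_comp[OF A A id b B _ _ _ p])
      show "dpoly_eval A A \<phi> (\<lambda>x. x) b ` carrier (dpoly_ring G A Y) \<subseteq> carrier A"
        using ring_hom_closed[OF dpoly_eval_ring_hom[OF A A id b]] by blast
      show "(\<lambda>x. x) \<in> ring_hom (A\<lparr>carrier := carrier A\<rparr>) B" using hom by simp
      show "\<phi> g s = \<psi> g s" if "g \<in> carrier G" "s \<in> carrier A" for g s
        using ext that by (simp add: difference_hom_def)
    qed
    then show ?thesis
      unfolding comp_def dpoly_eval_same_zero[OF zero, of B \<psi> "\<lambda>x. x" b p] .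
  qed
  moreover have "b \<in> Y \<rightarrow> carrier B" using b ring_hom_closed[OF hom] by auto
  ultimately show ?thesis using b by (simp add: common_zero_def zero)
qed

text \<open>The set \<open>P\<close> is the kernel of a homomorphism into a domain that commutes
  with the action.\<close>

lemma common_zero_prime_ideal:
  assumes A: "difference_field G A \<phi>" and B: "difference_domain G B \<psi>"
    and \<iota>: "\<iota> \<in> difference_hom G A \<phi> B \<psi>" and b: "b \<in> Y \<rightarrow> carrier B"
  defines "P \<equiv> {p \<in> carrier (dpoly_ring G A Y). dpoly_eval A B \<psi> \<iota> b p = \<zero>\<^bsub>B\<^esub>}"
  shows "primeideal P (dpoly_ring G A Y)"
    "difference_ideal G (dpoly_ring G A Y) (dpoly_act G A \<phi> Y) P"
proof -
  interpret A: difference_field G A \<phi> by fact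
  interpret B: difference_domain G B \<psi> by fact
  interpret R: difference_ring G "dpoly_ring G A Y" "dpoly_act G A \<phi> Y"
    by (rule A.difference_ring_dpoly_ring)
  note facts = A.difference_ring_axioms B.difference_ring_axioms \<iota> b
  let ?ev = "dpoly_eval A B \<psi> \<iota> b"
  have ev: "?ev \<in> ring_hom (dpoly_ring G A Y) B" by (rule dpoly_eval_ring_hom[OF facts])
  interpret ev: ring_hom_ring "dpoly_ring G A Y" B ?ev
    by (intro ring_hom_ringI2 R.ring_axioms B.ring_axioms ev)
  have ideal: "ideal P (dpoly_ring G A Y)"
    using ev.kernel_is_ideal unfolding P_def a_kernel_def' .
  show "primeideal P (dpoly_ring G A Y)"
  proof (rule primeidealI[OF ideal R.is_cring])
    show "carrier (dpoly_ring G A Y) \<noteq> P"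
      using R.one_closed ring_hom_one[OF ev] B.one_not_zero unfolding P_def by (metis (mono_tags, lifting) mem_Collect_eq)
    fix p q assume "p \<in> carrier (dpoly_ring G A Y)" "q \<in> carrier (dpoly_ring G A Y)"
      "p \<otimes>\<^bsub>dpoly_ring G A Y\<^esub> q \<in> P"
    then show "p \<in> P \<or> q \<in> P" by (auto simp: P_def B.integral_iff)
  qed
  show "difference_ideal G (dpoly_ring G A Y) (dpoly_act G A \<phi> Y) P"
    using ideal dpoly_eval_act[OF facts] R.act_closed B.act_zero
    by (auto simp: difference_ideal_def P_def)
qed

lemma (in difference_ring) indexed_const_difference_hom:
  "indexed_const \<in> difference_hom G R \<phi> (dpoly_ring G R Y) (dpoly_act G R \<phi> Y)"
proof -
  have "(indexed_const :: 'a \<Rightarrow> ('g \<times> 'b) multiset \<Rightarrow> 'a) \<in> ring_hom R (dpoly_ring G R Y)"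
  proof (rule ring_hom_memI)
    fix x y assume xy: "x \<in> carrier R" "y \<in> carrier R"
    then have "mpoly_mult R (indexed_const x) (indexed_const y) =
        (indexed_const (x \<otimes> y) :: ('g \<times> 'b) multiset \<Rightarrow> 'a)"
      by (subst mpoly_mult_const) (auto simp: indexed_const_def carrier_coeff_def)
    then show "(indexed_const (x \<otimes> y) :: ('g \<times> 'b) multiset \<Rightarrow> 'a) =
        indexed_const x \<otimes>\<^bsub>dpoly_ring G R Y\<^esub> indexed_const y"
      by (simp add: dpoly_ring_def mpoly_ring_def)
    show "(indexed_const (x \<oplus> y) :: ('g \<times> 'b) multiset \<Rightarrow> 'a) =
        indexed_const x \<oplus>\<^bsub>dpoly_ring G R Y\<^esub> indexed_const y"
      by (auto simp: dpoly_ring_def mpoly_ring_def indexed_padd_def) (auto simp: indexed_const_def)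
  qed (auto simp: dpoly_ring_def mpoly_ring_def intro: indexed_pset.indexed_const)
  then show ?thesis by (simp add: difference_hom_def dpoly_act_const)
qed

section \<open>Adjoining zeros\<close>

text \<open>The element \<open>name (n, E, f, g)\<close> is reserved for the fraction \<open>f/g\<close> in an extension by a zero of the
  system \<open>E\<close>, whose members are indexed by monomials. The invariant says that whenever such an
  element is present, the system already has a zero.\<close>

definition names_resolved ::
  "(nat \<times> (('g \<times> nat) multiset \<Rightarrow> ('g \<times> nat) multiset \<Rightarrow> 'u) \<times> (('g \<times> nat) multiset \<Rightarrow> 'u)
      \<times> (('g \<times> nat) multiset \<Rightarrow> 'u) \<Rightarrow> 'u)
    \<Rightarrow> ('g, 'w) monoid_scheme \<Rightarrow> 'u ring \<Rightarrow> ('g \<Rightarrow> 'u \<Rightarrow> 'u) \<Rightarrow> bool"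
  where "names_resolved name G R \<phi> \<longleftrightarrow>
    (\<forall>n E f g. name (n, E, f, g) \<in> carrier R \<longrightarrow>
      range E \<subseteq> carrier (dpoly_ring G R {1..n}) \<and>
      (\<exists>a. common_zero R R \<phi> (\<lambda>x. x) {1..n} (range E) a))"

text \<open>If \<open>P\<close> has a zero in \<open>M\<close>, then \<open>M\<close> itself serves
  as \<open>N\<close>. Otherwise the fraction field of the quotient by \<open>P\<close> is copied
  into the type of \<open>M\<close>: elements of \<open>M\<close> stay in place, and the others go
  to names that are free because \<open>P\<close> has no zero.\<close>

lemma prime_ideal_zero_extension:
  fixes G :: "('g, 'w) monoid_scheme" and M :: "'u ring" and n :: nat
  assumes M: "difference_field G M \<phi>" and res: "names_resolved name G M \<phi>"
    and name: "inj name"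
    and P: "primeideal P (dpoly_ring G M {1..n})"
      "difference_ideal G (dpoly_ring G M {1..n}) (dpoly_act G M \<phi> {1..n}) P"
  obtains N \<psi> a where "difference_field G N \<psi>" "names_resolved name G N \<psi>"
    "(\<lambda>x. x) \<in> difference_hom G M \<phi> N \<psi>" "common_zero N N \<psi> (\<lambda>x. x) {1..n} P a"
proof (cases "\<exists>a. common_zero M M \<phi> (\<lambda>x. x) {1..n} P a")
  case True
  then show thesis
    using that[OF M res] by (auto simp: difference_hom_def intro: ring_hom_memI)
next
  case False
  let ?Y = "{1..n}" and ?R = "dpoly_ring G M {1..n}"
  interpret M: difference_field G M \<phi> by fact
  interpret R: difference_ring G ?R "dpoly_act G M \<phi> ?Y" by (rule M.difference_ring_dpoly_ring)
  interpret P: primeideal P ?R by fact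
  obtain \<chi> where "difference_domain G (?R Quot P) \<chi>"
    and quot: "(+>\<^bsub>?R\<^esub>) P \<in> difference_hom G ?R (dpoly_act G M \<phi> ?Y) (?R Quot P) \<chi>"
    using R.quotient_difference_domain[OF P] .
  then interpret Q: difference_domain G "?R Quot P" \<chi> by simp
  obtain F :: "((('g \<times> nat) multiset \<Rightarrow> 'u) set \<times> (('g \<times> nat) multiset \<Rightarrow> 'u) set) set ring"
    and \<psi>F h where F: "difference_field G F \<psi>F"
    and h: "h \<in> difference_hom G (?R Quot P) \<chi> F \<psi>F"
    and F_frac: "\<forall>z\<in>carrier F. \<exists>a\<in>carrier (?R Quot P). \<exists>b\<in>carrier (?R Quot P).
      z = h a \<otimes>\<^bsub>F\<^esub> inv\<^bsub>F\<^esub> h b"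
    using Q.fraction_difference_field .
  interpret F: difference_field G F \<psi>F by fact
  \<comment> \<open>The residue class map followed by the map to the fraction field. It kills
    \<open>P\<close>, and every element of \<open>F\<close> is a quotient of two of its
    values.\<close>
  define H where "H = h \<circ> (+>\<^bsub>?R\<^esub>) P"
  have H: "H \<in> difference_hom G ?R (dpoly_act G M \<phi> ?Y) F \<psi>F"
    unfolding H_def using quot h by (rule difference_hom_comp)
  have HP: "H p = \<zero>\<^bsub>F\<^esub>" if "p \<in> P" for p
  proof -
    have "P +>\<^bsub>?R\<^esub> p = \<zero>\<^bsub>?R Quot P\<^esub>" using P.a_rcos_const[OF that] by (simp add: FactRing_def)
    moreover have "h \<in> ring_hom (?R Quot P) F" using h by (simp add: difference_hom_def)
    ultimately show ?thesis
      using ring_hom_zero[OF _ Q.ring_axioms F.ring_axioms] by (simp add: H_def)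
  qed
  have H_frac: "\<exists>fg. fst fg \<in> carrier ?R \<and> snd fg \<in> carrier ?R \<and> z = H (fst fg) \<otimes>\<^bsub>F\<^esub> inv\<^bsub>F\<^esub> H (snd fg)"
    if z: "z \<in> carrier F" for z
  proof -
    have coset: "\<exists>p\<in>carrier ?R. a = P +>\<^bsub>?R\<^esub> p" if "a \<in> carrier (?R Quot P)" for a
      using that by (auto simp: FactRing_def A_RCOSETS_def')
    obtain a b where "a \<in> carrier (?R Quot P)" "b \<in> carrier (?R Quot P)"
      "z = h a \<otimes>\<^bsub>F\<^esub> inv\<^bsub>F\<^esub> h b"
      using F_frac z by blast
    moreover then obtain p q where "p \<in> carrier ?R" "a = P +>\<^bsub>?R\<^esub> p" "q \<in> carrier ?R" "b = P +>\<^bsub>?R\<^esub> q"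
      using coset by metis
    ultimately show ?thesis by (intro exI[where x = "(p, q)"]) (simp add: H_def)
  qed
  define \<iota> where "\<iota> = H \<circ> M.indexed_const"
  have \<iota>: "\<iota> \<in> difference_hom G M \<phi> F \<psi>F"
    unfolding \<iota>_def using M.indexed_const_difference_hom H by (rule difference_hom_comp)
  then have "\<iota> \<in> ring_hom M F" by (simp add: difference_hom_def)
  then have \<iota>_inj: "inj_on \<iota> (carrier M)"
    by (rule non_trivial_field_hom_is_inj[OF _ M.field_axioms F.field_axioms])
  \<comment> \<open>A name has room only for a family indexed by monomials, so \<open>E\<close>
    represents \<open>P\<close> in it.\<close>
  obtain E :: "('g \<times> nat) multiset \<Rightarrow> ('g \<times> nat) multiset \<Rightarrow> 'u" where EP: "range E \<subseteq> P" and E: "\<forall>J. ideal J ?R \<and> range E \<subseteq> J \<longrightarrow> P \<subseteq> J"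
    using M.mpoly_ideal_generated_by_monomial_family[OF P.is_ideal[unfolded dpoly_ring_def]]
    unfolding dpoly_ring_def .
  \<comment> \<open>If such a name were present, the invariant would give a zero of
    \<open>E\<close>. The ideal of polynomials vanishing there contains \<open>E\<close>, hence
    \<open>P\<close>, against the case assumption.\<close>
  have fresh: "name (n, E, f, g) \<notin> carrier M" for f g
  proof
    assume "name (n, E, f, g) \<in> carrier M"
    then obtain a where a: "common_zero M M \<phi> (\<lambda>x. x) ?Y (range E) a"
      using res unfolding names_resolved_def by blast
    define J where "J = {p \<in> carrier ?R. dpoly_eval M M \<phi> (\<lambda>x. x) a p = \<zero>\<^bsub>M\<^esub>}"
    have "primeideal J ?R"
      unfolding J_def
    proof (rule common_zero_prime_ideal(1)[OF M])
      show "difference_domain G M \<phi>"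
        by (simp add: difference_domain_def M.difference_ring_axioms M.domain_axioms)
      show "(\<lambda>x. x) \<in> difference_hom G M \<phi> M \<phi>"
        by (auto simp: difference_hom_def intro: ring_hom_memI)
      show "a \<in> ?Y \<rightarrow> carrier M" using a by (simp add: common_zero_def)
    qed
    moreover have "range E \<subseteq> J" using a EP P.Icarr by (auto simp: J_def common_zero_def)
    ultimately have "P \<subseteq> J" using E by (simp add: primeideal.axioms(1))
    then have "common_zero M M \<phi> (\<lambda>x. x) ?Y P a" using a by (auto simp: J_def common_zero_def)
    then show False using False by blast
  qed
  \<comment> \<open>The element \<open>z\<close> can be recovered from its chosen numerator and
    denominator, so distinct elements receive distinct names.\<close>
  define rep where "rep z = (SOME fg. fst fg \<in> carrier ?R \<and> snd fg \<in> carrier ?R \<and>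
    z = H (fst fg) \<otimes>\<^bsub>F\<^esub> inv\<^bsub>F\<^esub> H (snd fg))" for z
  have rep: "z = H (fst (rep z)) \<otimes>\<^bsub>F\<^esub> inv\<^bsub>F\<^esub> H (snd (rep z))" if "z \<in> carrier F" for z
    using someI_ex[OF H_frac[OF that]] by (simp add: rep_def)
  \<comment> \<open>The copy of \<open>M\<close> in \<open>F\<close> is sent back to
    \<open>M\<close> itself, so that the relabelled field extends \<open>M\<close> by literal
    inclusion.\<close>
  define j where "j z = (if z \<in> \<iota> ` carrier M then inv_into (carrier M) \<iota> z
    else name (n, E, fst (rep z), snd (rep z)))" for z
  have j\<iota>: "j (\<iota> x) = x" if "x \<in> carrier M" for x
    using that \<iota>_inj by (simp add: j_def)
  have j_old: "j z \<in> carrier M" "\<iota> (j z) = z" if "z \<in> \<iota> ` carrier M" for z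
    using that j\<iota> by auto
  have j_new: "j z = name (n, E, fst (rep z), snd (rep z))" if "z \<notin> \<iota> ` carrier M" for z
    using that by (simp add: j_def)
  \<comment> \<open>Old and new values of \<open>j\<close> are told apart by membership in
    \<open>carrier M\<close>, as new names are fresh.\<close>
  have j_inj: "inj_on j (carrier F)"
  proof (rule inj_onI)
    fix w z assume wz: "w \<in> carrier F" "z \<in> carrier F" "j w = j z"
    show "w = z"
    proof (cases "j w \<in> carrier M")
      case True
      then have "w \<in> \<iota> ` carrier M" "z \<in> \<iota> ` carrier M" using wz(3) fresh j_new by metis+
      then show ?thesis using wz(3) j_old(2) by metis
    next
      case False
      then have "w \<notin> \<iota> ` carrier M" "z \<notin> \<iota> ` carrier M" using wz(3) j_old(1) by metis+
      then have "fst (rep w) = fst (rep z) \<and> snd (rep w) = snd (rep z)"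
        using wz(3) by (simp add: j_new inj_eq[OF name])
      then show ?thesis using rep wz(1,2) by metis
    qed
  qed
  obtain N :: "'u ring" and \<psi> where N: "difference_field G N \<psi>" and N_carrier: "carrier N = j ` carrier F"
    and j: "j \<in> difference_hom G F \<psi>F N \<psi>"
    using F.image_difference_field[OF j_inj] .
  interpret N: difference_field G N \<psi> by fact
  have ext: "(\<lambda>x. x) \<in> difference_hom G M \<phi> N \<psi>"
    by (rule difference_hom_cong[OF difference_hom_comp[OF \<iota> j] M.difference_ring_axioms])
      (simp add: j\<iota>)
  then have "(\<lambda>x. x) \<in> ring_hom M N" by (simp add: difference_hom_def)
  then have zero: "\<zero>\<^bsub>M\<^esub> = \<zero>\<^bsub>N\<^esub>" using ring_hom_zero M.ring_axioms N.ring_axioms by metis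
  \<comment> \<open>The generic zero of \<open>P\<close>: the residue classes of the variables,
    relabelled by \<open>j\<close>.\<close>
  define a where "a y = (j \<circ> H) (M.indexed_var (\<one>\<^bsub>G\<^esub>, y))" for y
  have jH: "j \<circ> H \<in> difference_hom G ?R (dpoly_act G M \<phi> ?Y) N \<psi>"
    using H j by (rule difference_hom_comp)
  have a_zero: "common_zero N N \<psi> (\<lambda>x. x) ?Y P a"
    unfolding common_zero_def
  proof (intro conjI ballI)
    show "a \<in> ?Y \<rightarrow> carrier N"
    proof
      fix y assume "y \<in> ?Y"
      then have "M.indexed_var (\<one>\<^bsub>G\<^esub>, y) \<in> carrier ?R"
        using Group.monoid.one_closed[OF group.is_monoid[OF M.group_G]]
        unfolding M.carrier_dpoly_ring M.indexed_var_def
        by (intro M.indexed_pset.indexed_pmult M.indexed_pset.indexed_const) auto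
      then show "a y \<in> carrier N"
        using jH ring_hom_closed[of "j \<circ> H" ?R N] by (auto simp: a_def difference_hom_def)
    qed
    fix p assume "p \<in> P"
    have "dpoly_eval M N \<psi> (\<lambda>x. x) a p = (j \<circ> H) p"
    proof (rule dpoly_eval_eq_hom[OF M.difference_ring_axioms N.difference_ring_axioms jH])
      show "c = (j \<circ> H) (M.indexed_const c)" if "c \<in> carrier M" for c
        using j\<iota>[OF that] by (simp add: \<iota>_def)
    qed (use \<open>p \<in> P\<close> P.Icarr in \<open>auto simp: a_def\<close>)
    also have "\<dots> = \<zero>\<^bsub>N\<^esub>"
      using HP[OF \<open>p \<in> P\<close>] j ring_hom_zero[of j F N] F.ring_axioms N.ring_axioms
      by (simp add: difference_hom_def)
    finally show "dpoly_eval N N \<psi> (\<lambda>x. x) a p = \<zero>\<^bsub>N\<^esub>"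
      unfolding dpoly_eval_same_zero[OF zero, of N \<psi> "\<lambda>x. x" a p] .
  qed
  have polys: "carrier (dpoly_ring G M Y) \<subseteq> carrier (dpoly_ring G N Y)" for Y :: "nat set"
    by (rule dpoly_ring_extension[OF M.difference_ring_axioms N.difference_ring_axioms ext])
  \<comment> \<open>A name in \<open>N\<close> either lies already in \<open>M\<close>, and the zero
    of its system is carried up, or is new. In the latter case injectivity of \<open>name\<close>
    identifies its system as \<open>E\<close>, which vanishes at \<open>a\<close>.\<close>
  have "names_resolved name G N \<psi>"
    unfolding names_resolved_def
  proof (intro allI impI)
    fix n' E' f g assume "name (n', E', f, g) \<in> carrier N"
    then obtain z where z: "z \<in> carrier F" "name (n', E', f, g) = j z" using N_carrier by blast
    show "range E' \<subseteq> carrier (dpoly_ring G N {1..n'}) \<and>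
      (\<exists>a. common_zero N N \<psi> (\<lambda>x. x) {1..n'} (range E') a)"
    proof (cases "z \<in> \<iota> ` carrier M")
      case True
      then have "name (n', E', f, g) \<in> carrier M" using z(2) j\<iota> by auto
      then obtain b where E': "range E' \<subseteq> carrier (dpoly_ring G M {1..n'})"
        and b: "common_zero M M \<phi> (\<lambda>x. x) {1..n'} (range E') b"
        using res unfolding names_resolved_def by blast
      have "b \<in> {1..n'} \<rightarrow> carrier M" using b by (simp add: common_zero_def)
      with E' b have "common_zero N N \<psi> (\<lambda>x. x) {1..n'} (range E') b"
        using common_zero_extension[OF M.difference_ring_axioms N.difference_ring_axioms ext] by blast
      then show ?thesis using E' polys by blast
    next
      case False
      then have "n' = n" "E' = E" using z(2) by (simp_all add: j_new inj_eq[OF name])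
      moreover have "common_zero N N \<psi> (\<lambda>x. x) ?Y (range E) a"
        using a_zero EP by (auto simp: common_zero_def)
      moreover have "range E \<subseteq> carrier (dpoly_ring G N ?Y)" using EP P.Icarr polys by blast
      ultimately show ?thesis by blast
    qed
  qed
  then show thesis using that N ext a_zero by blast
qed

section \<open>Maximal extensions\<close>

text \<open>Any two elements of the union lie in a common member, so sums, products and translates
  can be computed there.\<close>

lemma difference_field_chain_union:
  fixes C :: "('u ring \<times> ('g \<Rightarrow> 'u \<Rightarrow> 'u)) set" and G :: "('g, 'w) monoid_scheme"
  assumes "C \<noteq> {}"
    and fld: "\<And>R \<phi>. (R, \<phi>) \<in> C \<Longrightarrow> difference_field G R \<phi>"
    and chain: "\<And>R \<phi> S \<psi>. (R, \<phi>) \<in> C \<Longrightarrow> (S, \<psi>) \<in> C \<Longrightarrow>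
      (\<lambda>x. x) \<in> difference_hom G R \<phi> S \<psi> \<or> (\<lambda>x. x) \<in> difference_hom G S \<psi> R \<phi>"
  obtains U :: "'u ring" and \<chi> where "difference_field G U \<chi>" "carrier U = (\<Union>(R, \<phi>)\<in>C. carrier R)"
    "\<And>R \<phi>. (R, \<phi>) \<in> C \<Longrightarrow> (\<lambda>x. x) \<in> difference_hom G R \<phi> U \<chi>"
proof -
  define D where "D = fst ` C"
  define U where "U = union_ring D"
  have D_fld: "field R" if "R \<in> D" for R
    using that fld by (auto simp: D_def difference_field_def)
  \<comment> \<open>The relation \<open>\<lesssim>\<close> says that the identity is a ring
    homomorphism. The underlying fields thus form a chain, and their union is a field.\<close>
  have D_chain: "R \<lesssim> S \<or> S \<lesssim> R" if "R \<in> D" "S \<in> D" for R S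
    using that chain unfolding D_def difference_hom_def iso_incl.simps id_def by force
  note D = D_fld D_chain
  have "field U" unfolding U_def using union_ring_is_field[OF D] \<open>C \<noteq> {}\<close> by (auto simp: D_def)
  then interpret U: field U .
  obtain R0 \<phi>0 where "(R0, \<phi>0) \<in> C" using \<open>C \<noteq> {}\<close> by auto
  then interpret R0: difference_field G R0 \<phi>0 by (rule fld)
  have carrier_U: "carrier U = (\<Union>(R, \<phi>)\<in>C. carrier R)"
    by (simp add: U_def union_ring_carrier D_def image_image case_prod_unfold)
  have common: "\<exists>(R, \<phi>)\<in>C. x \<in> carrier R \<and> y \<in> carrier R" if "x \<in> carrier U" "y \<in> carrier U" for x y
  proof -
    obtain R where "R \<in> D" "{x, y} \<subseteq> carrier R"
      using exists_superset_carrier[OF D, where S = "{x, y}"] \<open>x \<in> carrier U\<close> \<open>y \<in> carrier U\<close>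
      unfolding U_def by blast
    then show ?thesis by (auto simp: D_def)
  qed
  have laws: "x \<otimes>\<^bsub>U\<^esub> y = x \<otimes>\<^bsub>R\<^esub> y" "x \<oplus>\<^bsub>U\<^esub> y = x \<oplus>\<^bsub>R\<^esub> y" "\<one>\<^bsub>U\<^esub> = \<one>\<^bsub>R\<^esub>" "x \<in> carrier U"
    if "(R, \<phi>) \<in> C" "x \<in> carrier R" "y \<in> carrier R" for R \<phi> x y
  proof -
    have "R \<in> D" using that(1) by (force simp: D_def)
    show "x \<otimes>\<^bsub>U\<^esub> y = x \<otimes>\<^bsub>R\<^esub> y"
      unfolding U_def by (rule same_laws(1)[OF D \<open>R \<in> D\<close> that(2,3)])
    show "x \<oplus>\<^bsub>U\<^esub> y = x \<oplus>\<^bsub>R\<^esub> y"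
      unfolding U_def by (rule same_laws(2)[OF D \<open>R \<in> D\<close> that(2,3)])
    show "\<one>\<^bsub>U\<^esub> = \<one>\<^bsub>R\<^esub>"
      unfolding U_def by (rule same_one_same_zero(1)[OF D \<open>R \<in> D\<close>])
    show "x \<in> carrier U" using that by (auto simp: carrier_U)
  qed
  have agree: "\<phi> g x = \<psi> g x"
    if "(R, \<phi>) \<in> C" "(S, \<psi>) \<in> C" "g \<in> carrier G" "x \<in> carrier R" "x \<in> carrier S" for R \<phi> S \<psi> g x
    using chain[OF that(1,2)] that(3-) by (auto simp: difference_hom_def)
  \<comment> \<open>A translate is computed in some member containing \<open>x\<close>; by
    \<open>agree\<close> the choice of the member does not matter.\<close>
  define \<chi> where "\<chi> g = (\<lambda>x\<in>carrier U. (SOME y. \<exists>(R, \<phi>)\<in>C. x \<in> carrier R \<and> y = \<phi> g x))" for g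
  have \<chi>: "\<chi> g x = \<phi> g x" if "(R, \<phi>) \<in> C" "g \<in> carrier G" "x \<in> carrier R" for R \<phi> g x
  proof -
    have "\<exists>(R, \<phi>)\<in>C. x \<in> carrier R \<and> \<chi> g x = \<phi> g x"
      using someI[of "\<lambda>y. \<exists>(R, \<phi>)\<in>C. x \<in> carrier R \<and> y = \<phi> g x" "\<phi> g x"] that
      by (auto simp: \<chi>_def carrier_U)
    then show ?thesis using agree that by fastforce
  qed
  have "difference_ring G U \<chi>"
  proof (rule difference_ringI)
    fix g assume g: "g \<in> carrier G"
    show "\<chi> g \<in> ring_hom U U"
    proof (rule ring_hom_memI)
      fix x y assume "x \<in> carrier U" "y \<in> carrier U"
      then obtain R \<phi> where R: "(R, \<phi>) \<in> C" and xy: "x \<in> carrier R" "y \<in> carrier R" using common by blast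
      interpret R: difference_field G R \<phi> using R by (rule fld)
      have gxy: "\<phi> g x \<in> carrier R" "\<phi> g y \<in> carrier R" using xy g by (simp_all add: R.act_closed)
      show "\<chi> g x \<in> carrier U" using laws(4)[OF R gxy(1) gxy(1)] \<chi>[OF R g xy(1)] by simp
      show "\<chi> g (x \<otimes>\<^bsub>U\<^esub> y) = \<chi> g x \<otimes>\<^bsub>U\<^esub> \<chi> g y"
        using g xy gxy by (simp add: laws[OF R] \<chi>[OF R] ring_hom_mult[OF R.act_hom])
      show "\<chi> g (x \<oplus>\<^bsub>U\<^esub> y) = \<chi> g x \<oplus>\<^bsub>U\<^esub> \<chi> g y"
        using g xy gxy by (simp add: laws[OF R] \<chi>[OF R] ring_hom_add[OF R.act_hom])
    next
      show "\<chi> g \<one>\<^bsub>U\<^esub> = \<one>\<^bsub>U\<^esub>"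
        using g \<open>(R0, \<phi>0) \<in> C\<close>
        by (simp add: laws(3)[of R0 \<phi>0 "\<one>\<^bsub>R0\<^esub>" "\<one>\<^bsub>R0\<^esub>"] \<chi>[of R0 \<phi>0] ring_hom_one[OF R0.act_hom])
    qed
    show "\<chi> g \<in> extensional (carrier U)" by (simp add: \<chi>_def)
    fix h x assume h: "h \<in> carrier G" and "x \<in> carrier U"
    then obtain R \<phi> where R: "(R, \<phi>) \<in> C" "x \<in> carrier R" using common by blast
    interpret R: difference_field G R \<phi> using R(1) by (rule fld)
    interpret G: Group.group G by (rule R.group_G)
    show "\<chi> (g \<otimes>\<^bsub>G\<^esub> h) x = \<chi> g (\<chi> h x)"
      using g h R(2) by (simp add: \<chi>[OF R(1)] R.act_mult R.act_closed)
  next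
    fix x assume "x \<in> carrier U"
    then obtain R \<phi> where R: "(R, \<phi>) \<in> C" "x \<in> carrier R" using common by blast
    interpret R: difference_field G R \<phi> using R(1) by (rule fld)
    interpret G: Group.group G by (rule R.group_G)
    show "\<chi> \<one>\<^bsub>G\<^esub> x = x" using R(2) by (simp add: \<chi>[OF R(1)] R.act_one)
  qed (rule U.is_cring R0.group_G)+
  then have "difference_field G U \<chi>" by (simp add: difference_field_def U.field_axioms)
  moreover have "(\<lambda>x. x) \<in> difference_hom G R \<phi> U \<chi>" if "(R, \<phi>) \<in> C" for R \<phi>
  proof -
    interpret R: difference_field G R \<phi> using that by (rule fld)
    have "(\<lambda>x. x) \<in> ring_hom R U"
      by (rule ring_hom_memI) (simp_all add: laws[OF that] laws(3)[OF that R.one_closed R.one_closed])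
    then show ?thesis by (simp add: difference_hom_def \<chi>[OF that])
  qed
  ultimately show thesis using that carrier_U by blast
qed

text \<open>Hausdorff's maximum principle is used instead of Zorn's lemma because inclusion is not
  antisymmetric: the operations are arbitrary outside the carrier.\<close>

lemma maximal_named_extension:
  fixes G :: "('g, 'w) monoid_scheme" and K :: "'u ring"
  assumes K: "difference_field G K \<phi>" and res: "names_resolved name G K \<phi>"
  obtains M :: "'u ring" and \<psi> where "difference_field G M \<psi>" "names_resolved name G M \<psi>"
    "(\<lambda>x. x) \<in> difference_hom G K \<phi> M \<psi>"
    "\<forall>(N :: 'u ring) \<chi>. difference_field G N \<chi> \<longrightarrow> names_resolved name G N \<chi> \<longrightarrow>
      (\<lambda>x. x) \<in> difference_hom G M \<psi> N \<chi> \<longrightarrow> carrier N \<subseteq> carrier M"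
proof -
  define A where "A = {(M, \<psi>). difference_field G M \<psi> \<and> names_resolved name G M \<psi> \<and>
    (\<lambda>x. x) \<in> difference_hom G K \<phi> M \<psi>}"
  define ext where "ext = (\<lambda>(M, \<psi>) (N, \<chi>). (\<lambda>x. x) \<in> difference_hom G (M :: 'u ring) \<psi> (N :: 'u ring) \<chi>)"
  interpret pred_on A ext .
  have ext_refl: "ext M M" for M
    by (auto simp: ext_def difference_hom_def intro: ring_hom_memI)
  have ext_trans: "ext M N \<Longrightarrow> ext N L \<Longrightarrow> ext M L" for M N L
    by (cases M; cases N; cases L)
      (use difference_hom_comp[where f = "\<lambda>x. x :: 'u" and g = "\<lambda>x. x"] in \<open>auto simp: ext_def comp_def\<close>)
  obtain C where C: "maxchain C" using Hausdorff by blast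
  then have "chain C" by (simp add: maxchain_def)
  then have CA: "C \<subseteq> A" by (simp add: chain_def)
  have C_total: "ext M N \<or> ext N M" if "M \<in> C" "N \<in> C" for M N
    using chain_total[OF \<open>chain C\<close> that] ext_refl[of M] by auto
  \<comment> \<open>A member of \<open>A\<close> above the whole chain could be added to it, so a
    maximal chain contains it already.\<close>
  have C_max: "M \<in> C" if "M \<in> A" "\<And>N. N \<in> C \<Longrightarrow> ext N M" for M
  proof (rule ccontr)
    assume "M \<notin> C"
    have "chain (insert M C)"
      using that CA C_total unfolding chain_def by blast
    then show False using C \<open>M \<notin> C\<close> unfolding maxchain_def by blast
  qed
  have KA: "(K, \<phi>) \<in> A" using K res ext_refl[of "(K, \<phi>)"] by (simp add: A_def ext_def)
  \<comment> \<open>If the chain were empty, \<open>K\<close> would be above all its members and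
    hence belong to it.\<close>
  have "C \<noteq> {}" using C_max[OF KA] by blast
  obtain U :: "'u ring" and \<chi> where U: "difference_field G U \<chi>" and U_carrier: "carrier U = (\<Union>(R, \<psi>)\<in>C. carrier R)"
    and U_ext: "\<And>R \<psi>. (R, \<psi>) \<in> C \<Longrightarrow> (\<lambda>x. x) \<in> difference_hom G R \<psi> U \<chi>"
  proof (rule difference_field_chain_union[OF \<open>C \<noteq> {}\<close>, of G])
    show "difference_field G R \<psi>" if "(R, \<psi>) \<in> C" for R \<psi> using that CA by (auto simp: A_def)
    show "(\<lambda>x. x) \<in> difference_hom G R \<phi> S \<psi> \<or> (\<lambda>x. x) \<in> difference_hom G S \<psi> R \<phi>"
      if "(R, \<phi>) \<in> C" "(S, \<psi>) \<in> C" for R \<phi> S \<psi>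
      using C_total[OF that] by (simp add: ext_def)
  qed (rule that)
  interpret U: difference_field G U \<chi> by fact
  have U_res: "names_resolved name G U \<chi>"
    unfolding names_resolved_def
  proof (intro allI impI)
    fix n E f g assume "name (n, E, f, g) \<in> carrier U"
    \<comment> \<open>A name in the union occurs in one member of the chain, and the zero found
      there remains a zero in \<open>U\<close>.\<close>
    then obtain R \<psi> where R: "(R, \<psi>) \<in> C" "name (n, E, f, g) \<in> carrier R" using U_carrier by auto
    interpret R: difference_field G R \<psi> using R(1) CA by (auto simp: A_def)
    have "names_resolved name G R \<psi>" using R(1) CA by (auto simp: A_def)
    then obtain a where E: "range E \<subseteq> carrier (dpoly_ring G R {1..n})"
      and a: "common_zero R R \<psi> (\<lambda>x. x) {1..n} (range E) a"
      using R(2) unfolding names_resolved_def by blast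
    note facts = R.difference_ring_axioms U.difference_ring_axioms U_ext[OF R(1)]
    have "a \<in> {1..n} \<rightarrow> carrier R" using a by (simp add: common_zero_def)
    then have "common_zero U U \<chi> (\<lambda>x. x) {1..n} (range E) a"
      using common_zero_extension[OF facts E] a by blast
    moreover have "range E \<subseteq> carrier (dpoly_ring G U {1..n})"
      using E dpoly_ring_extension[OF facts] by (rule subset_trans)
    ultimately show "range E \<subseteq> carrier (dpoly_ring G U {1..n}) \<and>
        (\<exists>a. common_zero U U \<chi> (\<lambda>x. x) {1..n} (range E) a)" by blast
  qed
  have U_max: "ext N (U, \<chi>)" if "N \<in> C" for N using U_ext that by (cases N) (simp add: ext_def)
  have KU: "ext (K, \<phi>) (U, \<chi>)"
  proof -
    obtain R \<psi> where R: "(R, \<psi>) \<in> C" using \<open>C \<noteq> {}\<close> by auto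
    then have "ext (K, \<phi>) (R, \<psi>)" using CA by (auto simp: A_def ext_def)
    then show ?thesis using U_max[OF R] by (rule ext_trans)
  qed
  show thesis
  proof (rule that[OF U U_res], safe)
    show "(\<lambda>x. x) \<in> difference_hom G K \<phi> U \<chi>" using KU by (simp add: ext_def)
  next
    fix N \<psi> x assume N: "difference_field G N \<psi>" "names_resolved name G N \<psi>"
      "(\<lambda>x. x) \<in> difference_hom G U \<chi> N \<psi>"
    then have UN: "ext (U, \<chi>) (N, \<psi>)" by (simp add: ext_def)
    then have "(N, \<psi>) \<in> A" using N ext_trans[OF KU UN] by (simp add: A_def ext_def)
    \<comment> \<open>An extension of \<open>U\<close> is above the whole chain, so it belongs to
      the chain and its carrier is part of the union.\<close>
    then have "(N, \<psi>) \<in> C" using C_max ext_trans[OF U_max UN] by blast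
    moreover assume "x \<in> carrier N"
    ultimately show "x \<in> carrier U" by (auto simp: U_carrier)
  qed
qed

section \<open>Difference closed extensions\<close>

text \<open>A zero of a prime difference ideal is a zero of every system inside it. A proper perfect
  ideal lies in such a prime, and a system with a zero in an extension domain lies in the prime of
  all polynomials vanishing there.\<close>

lemma difference_closedI:
  fixes G :: "('g, 'w) monoid_scheme" and R :: "('a, 'm) ring_scheme"
  assumes R: "difference_field G R \<phi>"
    and zeros: "\<And>(n :: nat) P. primeideal P (dpoly_ring G R {1..n}) \<Longrightarrow>
    difference_ideal G (dpoly_ring G R {1..n}) (dpoly_act G R \<phi> {1..n}) P \<Longrightarrow>
    \<exists>a. common_zero R R \<phi> (\<lambda>x. x) {1..n} P a"
  shows "difference_closed G R \<phi>"
proof -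
  interpret R: difference_field G R \<phi> by fact
  have sub: "\<exists>a. common_zero R R \<phi> (\<lambda>x. x) {1..n} I a"
    if "primeideal P (dpoly_ring G R {1..n})"
      "difference_ideal G (dpoly_ring G R {1..n}) (dpoly_act G R \<phi> {1..n}) P" "I \<subseteq> P" for n :: nat and I P
    using zeros[OF that(1,2)] that(3) by (auto simp: common_zero_def)
  have "\<exists>a. common_zero R R \<phi> (\<lambda>x. x) {1..n} I a"
    if I: "perfect_difference_ideal G (dpoly_ring G R {1..n}) (dpoly_act G R \<phi> {1..n}) I"
      "I \<noteq> carrier (dpoly_ring G R {1..n})" for n :: nat and I
    by (rule difference_ring.perfect_difference_ideal_in_prime[OF R.difference_ring_dpoly_ring I])
      (rule sub)
  then have "zeros_of_perfect_ideals G R \<phi>" unfolding zeros_of_perfect_ideals_def by blast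
  moreover have "zeros_from_extensions TYPE((('g \<times> nat) multiset \<Rightarrow> 'a) set) G R \<phi>"
    unfolding zeros_from_extensions_def
  proof (intro allI impI)
    fix n :: nat and E
    assume E: "E \<subseteq> carrier (dpoly_ring G R {1..n})"
    assume "\<exists>(B :: (('g \<times> nat) multiset \<Rightarrow> 'a) set ring) \<psi> \<iota> b. difference_domain G B \<psi> \<and>
      \<iota> \<in> difference_hom G R \<phi> B \<psi> \<and> inj_on \<iota> (carrier R) \<and> common_zero R B \<psi> \<iota> {1..n} E b"
    then obtain B :: "(('g \<times> nat) multiset \<Rightarrow> 'a) set ring" and \<psi> \<iota> b where
      B: "difference_domain G B \<psi>" "\<iota> \<in> difference_hom G R \<phi> B \<psi>"
      and b: "common_zero R B \<psi> \<iota> {1..n} E b" by blast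
    have "b \<in> {1..n} \<rightarrow> carrier B" using b by (simp add: common_zero_def)
    note P = common_zero_prime_ideal[OF R B this]
    show "\<exists>a. common_zero R R \<phi> (\<lambda>x. x) {1..n} E a"
      by (rule sub[OF P]) (use E b in \<open>auto simp: common_zero_def\<close>)
  qed
  ultimately show ?thesis
    by (simp add: difference_closed_def R)
qed

section \<open>Encoding names in the host type\<close>

text \<open>Every pair becomes a block of length two, so the word can be decoded. This turns
  monomials, written as lists of pairs, into words over the host alphabet.\<close>

lemma inj_concat_map_pair: "inj (\<lambda>xs. concat (map (\<lambda>(x, y). [f x, g y]) xs))" if "inj f" "inj g"
proof (rule injI)
  show "xs = ys" if "concat (map (\<lambda>(x, y). [f x, g y]) xs) = concat (map (\<lambda>(x, y). [f x, g y]) ys)"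
    for xs ys
    using that
  proof (induction xs arbitrary: ys)
    case Nil
    then show ?case by (cases ys) (simp_all add: case_prod_unfold)
  next
    case (Cons z xs)
    then obtain z' ys' where "ys = z' # ys'" by (cases ys) (simp_all add: case_prod_unfold)
    then show ?case
      using Cons by (cases z; cases z') (simp add: inj_eq[OF \<open>inj f\<close>] inj_eq[OF \<open>inj g\<close>])
  qed
qed

text \<open>A family of subsets of \<open>W\<close> indexed by \<open>I\<close> is a subset of \<open>I \<times> W\<close>, and \<open>I \<times> W\<close> embeds
  into \<open>W\<close>.\<close>

lemma inj_family_of_sets:
  assumes "infinite (UNIV :: 'w set)" and c: "inj (c :: 'i \<Rightarrow> 'w)"
  obtains node :: "('i \<Rightarrow> 'w set) \<Rightarrow> 'w set" where "inj node"
proof -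
  obtain e :: "'w \<times> 'w \<Rightarrow> 'w" where "bij_betw e (UNIV \<times> UNIV) UNIV"
    using card_of_Times_same_infinite[OF assms(1)] unfolding card_of_ordIso[symmetric] UNIV_Times_UNIV
    by blast
  then have e: "inj e" by (simp add: bij_betw_def)
  \<comment> \<open>The pairing \<open>e\<close> stores the index next to each member, so every
    \<open>h i\<close> can be read off from the code.\<close>
  define node where "node h = {e (c i, w) | i w. w \<in> h i}" for h
  have "e (c i, w) \<in> node h \<longleftrightarrow> w \<in> h i" for h i w
    by (auto simp: node_def inj_eq[OF e] inj_eq[OF c])
  then have eq: "h i = h' i" if "node h = node h'" for h h' i using that by blast
  have "inj node" by (intro injI ext) (rule eq)
  then show thesis by (rule that)
qed

text \<open>Base elements and names are both codes of families indexed by triples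
  \<open>(i, m, m')\<close>. In a name the slots 0, 1 and 2 hold \<open>n\<close>, \<open>E\<close>
  and \<open>f\<close>, and all later ones hold \<open>g\<close>. A base element has a set with a
  letter from \<open>'k\<close> in every slot, so slot 0 separates it from a name.\<close>

lemma host_naming:
  obtains base :: "'k \<Rightarrow> ('g, 'k) host"
    and name :: "nat \<times> (('g \<times> nat) multiset \<Rightarrow> ('g \<times> nat) multiset \<Rightarrow> ('g, 'k) host)
      \<times> (('g \<times> nat) multiset \<Rightarrow> ('g, 'k) host) \<times> (('g \<times> nat) multiset \<Rightarrow> ('g, 'k) host)
      \<Rightarrow> ('g, 'k) host"
  where "inj base" "inj name" "range name \<inter> range base = {}"
proof -
  have inf: "infinite (UNIV :: ('k + 'g + nat) list set)" by (rule infinite_UNIV_listI)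
  obtain e :: "('k + 'g + nat) list \<times> ('k + 'g + nat) list \<Rightarrow> ('k + 'g + nat) list"
    where "bij_betw e (UNIV \<times> UNIV) UNIV"
    using card_of_Times_same_infinite[OF inf] unfolding card_of_ordIso[symmetric] UNIV_Times_UNIV
    by blast
  then have e: "inj e" by (simp add: bij_betw_def)
  \<comment> \<open>Each monomial is represented by a chosen list, from which \<open>mset\<close>
    recovers it.\<close>
  obtain l :: "('g \<times> nat) multiset \<Rightarrow> ('g \<times> nat) list" where "\<And>m. mset (l m) = m"
    using ex_mset by metis
  then have l: "inj l" by (metis injI)
  let ?c = "\<lambda>xs. concat (map (\<lambda>(x, y). [Inr (Inl x), Inr (Inr y)]) xs) :: ('k + 'g + nat) list"
  have "inj ?c" by (rule inj_concat_map_pair) (simp_all add: inj_def)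
  then have "inj (?c \<circ> l)" using l by (rule inj_compose)
  then obtain d :: "('g \<times> nat) multiset \<Rightarrow> ('k + 'g + nat) list" where d: "inj d" by blast
  \<comment> \<open>The index triples embed into words, as the coding of families of sets
    requires.\<close>
  have "inj (\<lambda>(i :: nat, m, m'). e ([Inr (Inr i)], e (d m, d m')))"
    by (rule injI) (auto simp: inj_eq[OF e] inj_eq[OF d])
  then obtain node :: "(nat \<times> ('g \<times> nat) multiset \<times> ('g \<times> nat) multiset \<Rightarrow> ('g, 'k) host)
      \<Rightarrow> ('g, 'k) host" where node: "inj node"
    using inj_family_of_sets[OF inf] by blast
  define tag :: "nat \<Rightarrow> ('g, 'k) host" where "tag n = {[Inr (Inr n)]}" for n
  define \<beta> :: "'k \<Rightarrow> nat \<times> ('g \<times> nat) multiset \<times> ('g \<times> nat) multiset \<Rightarrow> ('g, 'k) host"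
    where "\<beta> k = (\<lambda>(i, m, m'). {[Inl k]})" for k
  define \<nu> :: "nat \<times> (('g \<times> nat) multiset \<Rightarrow> ('g \<times> nat) multiset \<Rightarrow> ('g, 'k) host)
      \<times> (('g \<times> nat) multiset \<Rightarrow> ('g, 'k) host) \<times> (('g \<times> nat) multiset \<Rightarrow> ('g, 'k) host)
      \<Rightarrow> nat \<times> ('g \<times> nat) multiset \<times> ('g \<times> nat) multiset \<Rightarrow> ('g, 'k) host"
    where "\<nu> = (\<lambda>(n, E, f, g) (i, m, m').
      if i = 0 then tag n else if i = 1 then E m m' else if i = 2 then f m else g m)"
  show thesis
  proof (rule that)
    have "\<beta> k = \<beta> k' \<Longrightarrow> k = k'" for k k' by (auto simp: \<beta>_def fun_eq_iff)
    then show "inj (node \<circ> \<beta>)" using node by (auto simp: inj_def)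
    have "\<nu> x (0, {#}, {#}) \<noteq> \<beta> k (0, {#}, {#})" for x k
      by (cases x) (simp add: \<nu>_def \<beta>_def tag_def)
    then have "\<nu> x \<noteq> \<beta> k" for x k by metis
    then show "range (node \<circ> \<nu>) \<inter> range (node \<circ> \<beta>) = {}"
      by (auto simp: inj_eq[OF node])
    have "x = y" if "\<nu> x = \<nu> y" for x y
    proof -
      obtain n E f g n' E' f' g' where xy: "x = (n, E, f, g)" "y = (n', E', f', g')"
        by (metis prod_cases4)
      have eq: "\<nu> x (i, m, m') = \<nu> y (i, m, m')" for i m m' using that by simp
      have "n = n'" using eq[of 0] by (simp add: \<nu>_def tag_def xy)
      moreover have "E m m' = E' m m'" "f m = f' m" "g m = g' m" for m m'
        using eq[of 1 m m'] eq[of 2 m m'] eq[of 3 m m'] by (simp_all add: \<nu>_def xy)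
      ultimately show ?thesis by (simp add: xy fun_eq_iff)
    qed
    then show "inj (node \<circ> \<nu>)" using node by (auto simp: inj_def)
  qed
qed

section \<open>Existence of a difference closed extension\<close>

theorem theorem9:
  fixes G :: "('g, 'w) monoid_scheme"
    and K :: "('k, 'm) ring_scheme"
    and \<phi> :: "'g \<Rightarrow> 'k \<Rightarrow> 'k"
  assumes "group G"
    and "difference_field G K \<phi>"
  shows "\<exists>(L :: ('g, 'k) host ring) \<psi> h.
    difference_closed G L \<psi> \<and>
    h \<in> difference_hom G K \<phi> L \<psi> \<and> inj_on h (carrier K)"
proof -
  obtain base :: "'k \<Rightarrow> ('g, 'k) host"
    and name :: "nat \<times> (('g \<times> nat) multiset \<Rightarrow> ('g \<times> nat) multiset \<Rightarrow> ('g, 'k) host)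
      \<times> (('g \<times> nat) multiset \<Rightarrow> ('g, 'k) host) \<times> (('g \<times> nat) multiset \<Rightarrow> ('g, 'k) host)
      \<Rightarrow> ('g, 'k) host"
    where base: "inj base" and name: "inj name" and disj: "range name \<inter> range base = {}"
    using host_naming .
  interpret K: difference_field G K \<phi> by fact
  have base_on: "inj_on base (carrier K)" using base by (rule inj_on_subset) simp
  obtain K' :: "('g, 'k) host ring" and \<phi>' where K': "difference_field G K' \<phi>'"
    and K'_carrier: "carrier K' = base ` carrier K" and base_hom: "base \<in> difference_hom G K \<phi> K' \<phi>'"
    using K.image_difference_field[OF base_on] .
  \<comment> \<open>No element of the copy of \<open>K\<close> is a name, so the invariant holds
    vacuously.\<close>
  have "names_resolved name G K' \<phi>'"
    using disj by (auto simp: names_resolved_def K'_carrier)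
  from maximal_named_extension[OF K' this]
  obtain M :: "('g, 'k) host ring" and \<psi> where M: "difference_field G M \<psi>"
    and res: "names_resolved name G M \<psi>"
    and ext: "(\<lambda>x. x) \<in> difference_hom G K' \<phi>' M \<psi>"
    and max: "\<forall>(N :: ('g, 'k) host ring) \<chi>. difference_field G N \<chi> \<longrightarrow> names_resolved name G N \<chi> \<longrightarrow>
      (\<lambda>x. x) \<in> difference_hom G M \<psi> N \<chi> \<longrightarrow> carrier N \<subseteq> carrier M" .
  interpret M: difference_field G M \<psi> by fact
  have "difference_closed G M \<psi>"
  proof (rule difference_closedI[OF M])
    fix n :: nat and P
    assume P: "primeideal P (dpoly_ring G M {1..n})"
      "difference_ideal G (dpoly_ring G M {1..n}) (dpoly_act G M \<psi> {1..n}) P"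
    interpret P: primeideal P "dpoly_ring G M {1..n}" by fact
    obtain N \<chi> a where N: "difference_field G N \<chi>" "names_resolved name G N \<chi>"
      "(\<lambda>x. x) \<in> difference_hom G M \<psi> N \<chi>" and a: "common_zero N N \<chi> (\<lambda>x. x) {1..n} P a"
      using prime_ideal_zero_extension[OF M res name P] .
    interpret N: difference_field G N \<chi> by fact
    \<comment> \<open>Maximality forces the carrier of \<open>N\<close> into that of
      \<open>M\<close>, so the coordinates of the zero already lie in \<open>M\<close>.\<close>
    have "a \<in> {1..n} \<rightarrow> carrier M" using a max N by (auto simp: common_zero_def)
    then show "\<exists>a. common_zero M M \<psi> (\<lambda>x. x) {1..n} P a"
      using common_zero_extension[OF M.difference_ring_axioms N.difference_ring_axioms N(3)
          P.a_subset] a by blast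
  qed
  moreover have "base \<in> difference_hom G K \<phi> M \<psi>"
    using difference_hom_comp[OF base_hom ext] by (simp add: comp_def)
  ultimately show ?thesis using base_on by blast
qed

end
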